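(* There exist constants $\epsilon>0$ and $C\in\mathbb{R}$ such that for all sufficiently large $n\in\mathbb{N}$ there is a norm $\|\cdot\|$ on $\mathbb{R}^n$ such that the normed space $X=(\mathbb{R}^n,\|\cdot\|)$ is strongly $C$-Euclidean but contains no 2-dimensional subspace that is both strongly $(1+\epsilon)$-Euclidean and strongly $(1+\epsilon)$-complemented.
   Context: $|\cdot|$ denotes the standard Euclidean norm on $\mathbb{R}^n$. Let $X=(\mathbb{R}^n,\|\cdot\|)$ be a normed space and let $\alpha\ge 1$. A linear subspace $Y\subset X$ (possibly $Y=X$) is strongly $\alpha$-Euclidean if there is a constant $t>0$ such that $t|y|\le\|y\|\le\alpha t|y|$ for every $y\in Y$. A subspace $Y\subset X$ is strongly $\alpha$-complemented if the orthogonal projection $P_Y$ from $\mathbb{R}^n$ onto $Y$ (orthogonal with respect to the standard inner product) satisfies $\|P_Yx\|\le\alpha\|x\|$ for every $x\in\mathbb{R}^n$. *)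

theory Defs
  imports "HOL-Analysis.Analysis" "HOL-Analysis.Finite_Function_Topology"
begin

text \<open>
  The dimension \<open>n\<close> is quantified inside the theorem, so \<open>\<real>\<^sup>n\<close> cannot be the type
  \<open>real ^ 'n\<close>.  It is modelled as the subspace of the finitely supported sequences
  \<open>nat \<Rightarrow>\<^sub>0 real\<close> that vanish outside \<open>{..<n}\<close>; \<^const>\<open>subspace\<close> and \<^const>\<open>dim\<close> are then
  the library notions for the real vector space \<open>nat \<Rightarrow>\<^sub>0 real\<close>.
  The type class \<open>norm\<close> of this type is the \<open>l\<^sub>1\<close> norm and is not used here.
\<close>

definition Rn :: "nat \<Rightarrow> (nat \<Rightarrow>\<^sub>0 real) set" where
  "Rn n = {x. Poly_Mapping.keys x \<subseteq> {..<n}}"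

definition std_inner :: "(nat \<Rightarrow>\<^sub>0 real) \<Rightarrow> (nat \<Rightarrow>\<^sub>0 real) \<Rightarrow> real" where
  "std_inner x y = (\<Sum>i\<in>Poly_Mapping.keys x. Poly_Mapping.lookup x i * Poly_Mapping.lookup y i)"

definition std_norm :: "(nat \<Rightarrow>\<^sub>0 real) \<Rightarrow> real" where
  "std_norm x = L2_set (Poly_Mapping.lookup x) (Poly_Mapping.keys x)"

definition norm_on :: "'a::real_vector set \<Rightarrow> ('a \<Rightarrow> real) \<Rightarrow> bool" where
  "norm_on V N \<longleftrightarrow>
     (\<forall>x\<in>V. 0 \<le> N x) \<and>
     (\<forall>x\<in>V. N x = 0 \<longleftrightarrow> x = 0) \<and>
     (\<forall>c. \<forall>x\<in>V. N (c *\<^sub>R x) = \<bar>c\<bar> * N x) \<and>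
     (\<forall>x\<in>V. \<forall>y\<in>V. N (x + y) \<le> N x + N y)"

definition strongly_euclidean ::
    "real \<Rightarrow> ((nat \<Rightarrow>\<^sub>0 real) \<Rightarrow> real) \<Rightarrow> (nat \<Rightarrow>\<^sub>0 real) set \<Rightarrow> bool" where
  "strongly_euclidean \<alpha> N Y \<longleftrightarrow>
     (\<exists>t>0. \<forall>y\<in>Y. t * std_norm y \<le> N y \<and> N y \<le> \<alpha> * t * std_norm y)"

text \<open>
  The description below determines the projection whenever \<open>Y\<close> is a subspace of some
  \<open>\<real>\<^sup>n\<close>; see \<open>orth_proj_ex1\<close>.
\<close>

definition orth_proj :: "(nat \<Rightarrow>\<^sub>0 real) set \<Rightarrow> (nat \<Rightarrow>\<^sub>0 real) \<Rightarrow> (nat \<Rightarrow>\<^sub>0 real)" where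
  "orth_proj Y x = (THE p. p \<in> Y \<and> (\<forall>y\<in>Y. std_inner (x - p) y = 0))"

definition strongly_complemented ::
    "nat \<Rightarrow> real \<Rightarrow> ((nat \<Rightarrow>\<^sub>0 real) \<Rightarrow> real) \<Rightarrow> (nat \<Rightarrow>\<^sub>0 real) set \<Rightarrow> bool" where
  "strongly_complemented n \<alpha> N Y \<longleftrightarrow> (\<forall>x\<in>Rn n. N (orth_proj Y x) \<le> \<alpha> * N x)"

lemma lookup_scaleR: "Poly_Mapping.lookup (c *\<^sub>R x) i = c *\<^sub>R Poly_Mapping.lookup x i"
proof -
  have "finite {i. c *\<^sub>R Poly_Mapping.lookup x i \<noteq> 0}"
    by (rule finite_subset[OF _ finite_keys[of x]]) (auto simp: in_keys_iff)
  then show ?thesis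
    by (simp add: scaleR_poly_mapping_def lookup_Abs_poly_mapping)
qed

lemma std_inner_eq:
  assumes "finite A" "Poly_Mapping.keys x \<subseteq> A"
  shows "std_inner x y = (\<Sum>i\<in>A. Poly_Mapping.lookup x i * Poly_Mapping.lookup y i)"
  unfolding std_inner_def
  by (rule sum.mono_neutral_left) (use assms in \<open>auto simp: in_keys_iff\<close>)

lemma std_inner_commute: "std_inner x y = std_inner y x"
proof -
  let ?A = "Poly_Mapping.keys x \<union> Poly_Mapping.keys y"
  show ?thesis
    using std_inner_eq[of ?A x y] std_inner_eq[of ?A y x] by (simp add: mult.commute)
qed

lemma std_inner_add_right: "std_inner x (y + z) = std_inner x y + std_inner x z"
  by (simp add: std_inner_def lookup_add algebra_simps sum.distrib)

lemma std_inner_diff_right: "std_inner x (y - z) = std_inner x y - std_inner x z"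
  by (simp add: std_inner_def lookup_minus algebra_simps sum_subtractf)

lemma std_inner_scaleR_right: "std_inner x (c *\<^sub>R y) = c * std_inner x y"
  by (simp add: std_inner_def lookup_scaleR sum_distrib_left mult_ac)

lemma std_inner_add_left: "std_inner (x + y) z = std_inner x z + std_inner y z"
  by (metis std_inner_commute std_inner_add_right)

lemma std_inner_diff_left: "std_inner (x - y) z = std_inner x z - std_inner y z"
  by (metis std_inner_commute std_inner_diff_right)

lemma std_inner_scaleR_left: "std_inner (c *\<^sub>R x) y = c * std_inner x y"
  by (metis std_inner_commute std_inner_scaleR_right)

lemma std_inner_self_eq_0: "std_inner x x = 0 \<longleftrightarrow> x = 0"
  by (auto simp: std_inner_def sum_nonneg_eq_0_iff in_keys_iff intro!: poly_mapping_eqI)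

lemma std_norm_eq_sqrt_inner: "std_norm x = sqrt (std_inner x x)"
  by (simp add: std_norm_def std_inner_def L2_set_def power2_eq_square)

lemma subspace_Rn: "subspace (Rn n)"
  unfolding subspace_def Rn_def
  by (auto simp: in_keys_iff lookup_add lookup_scaleR subset_iff) (metis add_0)

lemma orth_proj_exists_span:
  assumes "finite B"
  shows "\<exists>p\<in>span B. \<forall>y\<in>span B. std_inner (x - p) y = 0"
  using assms
proof (induction B arbitrary: x)
  case empty
  then show ?case by (simp add: std_inner_def)
next
  case (insert b B)
  obtain q where q: "q \<in> span B" "\<forall>y\<in>span B. std_inner (b - q) y = 0"
    using insert.IH by blast
  obtain p where p: "p \<in> span B" "\<forall>y\<in>span B. std_inner (x - p) y = 0"
    using insert.IH by blast
  define r where "r = b - q"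
  define c where "c = std_inner (x - p) r / std_inner r r"
  have sub: "span B \<subseteq> span (insert b B)" by (rule span_mono) auto
  have r: "r \<in> span (insert b B)"
    unfolding r_def using q(1) sub by (intro span_diff) (auto intro: span_base)
  have cr: "std_inner (x - p) r - c * std_inner r r = 0"
  proof (cases "r = 0")
    case True
    then show ?thesis by (simp add: std_inner_def)
  next
    case False
    then show ?thesis by (simp add: c_def std_inner_self_eq_0)
  qed
  show ?case
  proof (rule bexI[of _ "p + c *\<^sub>R r"], rule ballI)
    show "p + c *\<^sub>R r \<in> span (insert b B)"
      using p(1) sub r by (intro span_add span_scale) auto
    fix y assume "y \<in> span (insert b B)"
    then obtain k where k: "y - k *\<^sub>R b \<in> span B" using span_breakdown_eq by blast
    define z where "z = (y - k *\<^sub>R b) + k *\<^sub>R q"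
    have z: "z \<in> span B" unfolding z_def using k q(1) by (intro span_add span_scale)
    have y: "y = z + k *\<^sub>R r" by (simp add: z_def r_def algebra_simps)
    have "x - (p + c *\<^sub>R r) = (x - p) - c *\<^sub>R r" by simp
    then have "std_inner (x - (p + c *\<^sub>R r)) y =
        std_inner (x - p) z - c * std_inner r z + k * (std_inner (x - p) r - c * std_inner r r)"
      unfolding y
      by (simp add: std_inner_add_right std_inner_add_left std_inner_diff_left
            std_inner_scaleR_left std_inner_scaleR_right algebra_simps)
    then show "std_inner (x - (p + c *\<^sub>R r)) y = 0"
      using p(2) q(2) z cr by (simp add: r_def)
  qed
qed

lemma Rn_subset_span: "Rn n \<subseteq> span ((\<lambda>i. Poly_Mapping.single i 1) ` {..<n})"
proof
  fix x assume x: "x \<in> Rn n"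
  have "x = (\<Sum>i<n. Poly_Mapping.lookup x i *\<^sub>R Poly_Mapping.single i 1)"
  proof (rule poly_mapping_eqI)
    fix k
    have "Poly_Mapping.lookup (\<Sum>i<n. Poly_Mapping.lookup x i *\<^sub>R Poly_Mapping.single i 1) k
        = (\<Sum>i<n. if i = k then Poly_Mapping.lookup x i else 0)"
      unfolding lookup_sum
      by (intro sum.cong) (auto simp: lookup_scaleR lookup_single when_def)
    also have "\<dots> = Poly_Mapping.lookup x k"
      using x by (auto simp: Rn_def in_keys_iff)
    finally show "Poly_Mapping.lookup x k =
        Poly_Mapping.lookup (\<Sum>i<n. Poly_Mapping.lookup x i *\<^sub>R Poly_Mapping.single i 1) k" ..
  qed
  also have "\<dots> \<in> span ((\<lambda>i. Poly_Mapping.single i 1) ` {..<n})"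
    by (intro span_sum span_scale span_base) auto
  finally show "x \<in> span ((\<lambda>i. Poly_Mapping.single i 1) ` {..<n})" .
qed

lemma orth_proj_ex1:
  assumes Y: "subspace Y" "Y \<subseteq> Rn n"
  shows "\<exists>!p. p \<in> Y \<and> (\<forall>y\<in>Y. std_inner (x - p) y = 0)"
proof (rule ex_ex1I)
  obtain B where B: "B \<subseteq> Y" "independent B" "span B = Y"
    using Y(1) by (metis basis_exists span_subspace)
  have "B \<subseteq> span ((\<lambda>i. Poly_Mapping.single i 1) ` {..<n})"
    using B(1) Y(2) Rn_subset_span[of n] by blast
  then have "finite B"
    using independent_span_bound[OF _ B(2)] by blast
  then show "\<exists>p. p \<in> Y \<and> (\<forall>y\<in>Y. std_inner (x - p) y = 0)"
    using orth_proj_exists_span[of B x] B(3) by blast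
next
  fix p q
  assume pq: "p \<in> Y \<and> (\<forall>y\<in>Y. std_inner (x - p) y = 0)"
    "q \<in> Y \<and> (\<forall>y\<in>Y. std_inner (x - q) y = 0)"
  then have "p - q \<in> Y" using Y(1) subspace_diff by blast
  then have "std_inner ((x - q) - (x - p)) (p - q) = 0"
    using pq by (simp add: std_inner_diff_left)
  then show "p = q" by (simp add: std_inner_self_eq_0)
qed

end

theory Submission
  imports Defs
begin

text \<open>
  A plane \<open>Y\<close> that is both strongly Euclidean and strongly complemented consists, up to small
  errors, of points \<open>y\<close> at which the gradient of the norm is parallel to \<open>y\<close>. The norm is the
  Orlicz (Luxemburg) norm of a Young function whose derivative is \<open>\<phi>(t) = t (4 + sin (ln \<bar>t\<bar>))\<close>.
  It is equivalent to the Euclidean norm because \<open>\<phi>(t) / t\<close> stays between positive constants, and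
  its gradient at \<open>y\<close> is parallel to the vector with coordinates \<open>\<phi>(y\<^sub>i)\<close>. That this vector is nearly
  parallel to \<open>y\<close> means that \<open>\<Sum>\<^sub>i\<^sub>j (\<phi>(y\<^sub>i) y\<^sub>j - \<phi>(y\<^sub>j) y\<^sub>i)\<^sup>2\<close> is small. When \<open>y = cos \<theta> u + sin \<theta> v\<close>
  runs through a circle of \<open>Y\<close>, the oscillation of \<open>\<phi>(t) / t\<close> at every scale makes the average of the
  \<open>(i, j)\<close> term at least a constant times \<open>(u\<^sub>i v\<^sub>j - u\<^sub>j v\<^sub>i)\<^sup>2\<close>, and by Lagrange's identity
  the sum of these squares is \<open>2 \<bar>u\<bar>\<^sup>2 \<bar>v\<bar>\<^sup>2\<close>. The average over \<open>\<theta>\<close> can be taken over a fixed finite set.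
\<close>

section \<open>The Young function\<close>

text \<open>The library's real \<open>ln\<close> is even with \<open>ln 0 = 0\<close>, so \<open>ln t\<close> below means \<open>ln \<bar>t\<bar>\<close>.
  The combination of \<open>sin\<close> and \<open>cos\<close> is chosen such that only \<open>sin\<close> remains in the derivative.\<close>
definition young :: "real \<Rightarrow> real" where
  "young t = t\<^sup>2 * (2 + (2 * sin (ln t) - cos (ln t)) / 5)"

definition young_deriv :: "real \<Rightarrow> real" where
  "young_deriv t = t * (4 + sin (ln t))"

lemma young_0 [simp]: "young 0 = 0" and young_deriv_0 [simp]: "young_deriv 0 = 0"
  by (simp_all add: young_def young_deriv_def)

lemma young_minus [simp]: "young (- t) = young t"
  by (simp add: young_def ln_minus)

text \<open>The bracket in \<open>young\<close> stays within 3/5 of 2. The rounder upper bound 4 is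
  a square and becomes the comparison constant 2 for the norm.\<close>

lemma young_bounds: "t\<^sup>2 \<le> young t" "young t \<le> 4 * t\<^sup>2"
proof -
  have "1 \<le> 2 + (2 * s - c) / 5 \<and> 2 + (2 * s - c) / 5 \<le> 4"
    if "s \<le> 1" "- 1 \<le> s" "c \<le> 1" "- 1 \<le> c" for s c :: real
    using that by (simp add: field_simps)
  from this[of "sin (ln t)" "cos (ln t)"]
  have b: "1 \<le> 2 + (2 * sin (ln t) - cos (ln t)) / 5" "2 + (2 * sin (ln t) - cos (ln t)) / 5 \<le> 4"
    by auto
  have "t\<^sup>2 * 1 \<le> young t" "young t \<le> t\<^sup>2 * 4"
    unfolding young_def by (intro mult_left_mono b zero_le_power2)+
  then show "t\<^sup>2 \<le> young t" "young t \<le> 4 * t\<^sup>2" by auto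
qed

lemma abs_young_deriv_le: "\<bar>young_deriv t\<bar> \<le> 5 * \<bar>t\<bar>"
proof -
  have "\<bar>4 + sin (ln t)\<bar> \<le> 5"
    using sin_le_one[of "ln t"] sin_ge_minus_one[of "ln t"] by linarith
  then show ?thesis
    using mult_left_mono[of "\<bar>4 + sin (ln t)\<bar>" 5 "\<bar>t\<bar>"] by (simp add: young_deriv_def abs_mult)
qed

lemma DERIV_ln_nonzero:
  fixes x :: real assumes "x \<noteq> 0"
  shows "DERIV ln x :> 1 / x"
proof (cases "x > 0")
  case True then show ?thesis by (rule DERIV_ln_divide)
next
  case False
  then have "DERIV (\<lambda>x. ln (- x)) x :> 1 / (- x) * (- 1)"
    using assms by (intro DERIV_chain2[OF DERIV_ln_divide]) (auto intro!: derivative_eq_intros)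
  then show ?thesis by (simp add: ln_minus)
qed

lemma DERIV_sin_ln: "x \<noteq> 0 \<Longrightarrow> DERIV (\<lambda>x. sin (ln x)) x :> cos (ln x) / x" for x :: real
  using DERIV_chain2[OF DERIV_sin DERIV_ln_nonzero] by fastforce

lemma DERIV_cos_ln: "x \<noteq> 0 \<Longrightarrow> DERIV (\<lambda>x. cos (ln x)) x :> - sin (ln x) / x" for x :: real
  using DERIV_chain2[OF DERIV_cos DERIV_ln_nonzero] by fastforce

lemma DERIV_young: "DERIV young t :> young_deriv t"
proof (cases "t = 0")
  case True
  \<comment> \<open>\<open>ln\<close> oscillates without limit in sine and cosine near 0, so the
    derivative there comes from the quadratic bound on \<open>young\<close>.\<close>
  have "(\<lambda>h. young h / h) \<midarrow>0\<rightarrow> 0"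
  proof (rule Lim_null_comparison)
    show "\<forall>\<^sub>F h in at 0. norm (young h / h) \<le> 4 * \<bar>h\<bar>"
    proof (rule eventuallyI)
      fix h :: real
      have "\<bar>young h\<bar> \<le> 4 * \<bar>h\<bar> * \<bar>h\<bar>"
        using young_bounds[of h] zero_le_power2[of h] by (simp add: power2_eq_square)
      then show "norm (young h / h) \<le> 4 * \<bar>h\<bar>"
        by (cases "h = 0") (auto simp: pos_divide_le_eq)
    qed
    show "(\<lambda>h::real. 4 * \<bar>h\<bar>) \<midarrow>0\<rightarrow> 0"
      by (auto intro!: tendsto_eq_intros)
  qed
  then show ?thesis using True by (simp add: DERIV_def)
next
  case False
  have "DERIV (\<lambda>x. x\<^sup>2 * (2 + (2 * S x - C x) / 5)) t :>
      t\<^sup>2 * ((2 * S' - C') / 5) + 2 * t * (2 + (2 * S t - C t) / 5)"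
    if "DERIV S t :> S'" "DERIV C t :> C'" for S C S' C'
    by (auto intro!: derivative_eq_intros that)
  from this[OF DERIV_sin_ln[OF False] DERIV_cos_ln[OF False]] show ?thesis
    unfolding young_def[abs_def] young_deriv_def
    by (rule DERIV_cong) (use False in \<open>simp add: field_simps power2_eq_square\<close>)
qed

text \<open>Away from 0 the derivative of \<open>young_deriv\<close> is 4 + sin (ln t) + cos (ln t),
  between 2 and 6. At 0 it does not exist, so an interval containing 0 is split there. The lower
  bound gives convexity, the upper bound smoothness.\<close>

lemma young_deriv_diff_bounds:
  assumes "x \<le> y"
  shows "2 * (y - x) \<le> young_deriv y - young_deriv x" "young_deriv y - young_deriv x \<le> 6 * (y - x)"
proof -
  have away: "2 * (y - x) \<le> young_deriv y - young_deriv x \<and> young_deriv y - young_deriv x \<le> 6 * (y - x)"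
    if "x \<le> y" "0 \<notin> {x..y}" for x y
  proof -
    have D: "DERIV young_deriv z :> 4 + sin (ln z) + cos (ln z)" if "z \<in> {x..y}" for z
    proof -
      have "z \<noteq> 0" using that \<open>0 \<notin> {x..y}\<close> by auto
      have "DERIV (\<lambda>x. x * (4 + S x)) z :> 4 + S z + z * S'" if "DERIV S z :> S'" for S S'
        by (auto intro!: derivative_eq_intros that)
      from this[OF DERIV_sin_ln[OF \<open>z \<noteq> 0\<close>]] show ?thesis
        unfolding young_deriv_def[abs_def] using \<open>z \<noteq> 0\<close> by simp
    qed
    show ?thesis
    proof (cases "x = y")
      case False
      then have "x < y" using that by simp
      then obtain z where z: "x < z" "z < y" "young_deriv y - young_deriv x = (y - x) * (4 + sin (ln z) + cos (ln z))"
        using MVT2[of x y young_deriv "\<lambda>z. 4 + sin (ln z) + cos (ln z)", OF _ D] by auto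
      have b: "2 \<le> 4 + sin (ln z) + cos (ln z)" "4 + sin (ln z) + cos (ln z) \<le> 6"
        using sin_le_one[of "ln z"] sin_ge_minus_one[of "ln z"] cos_le_one[of "ln z"] cos_ge_minus_one[of "ln z"]
        by linarith+
      show ?thesis
        using mult_left_mono[OF b(1), of "y - x"] mult_left_mono[OF b(2), of "y - x"] that z(3)
        by (auto simp: algebra_simps)
    qed auto
  qed
  have zero: "(if 0 \<le> t then 2 * t \<le> young_deriv t \<and> young_deriv t \<le> 6 * t
    else 6 * t \<le> young_deriv t \<and> young_deriv t \<le> 2 * t)" for t
  proof -
    have b: "2 \<le> 4 + sin (ln t)" "4 + sin (ln t) \<le> 6"
      using sin_le_one[of "ln t"] sin_ge_minus_one[of "ln t"] by linarith+
    show ?thesis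
      using mult_left_mono[OF b(1), of t] mult_left_mono[OF b(2), of t]
        mult_left_mono_neg[OF b(1), of t] mult_left_mono_neg[OF b(2), of t]
      by (auto simp: young_deriv_def algebra_simps)
  qed
  have "2 * (y - x) \<le> young_deriv y - young_deriv x \<and> young_deriv y - young_deriv x \<le> 6 * (y - x)"
  proof (cases "0 \<in> {x..y}")
    case True
    then show ?thesis using zero[of x] zero[of y] by (auto split: if_splits)
  qed (use away assms in auto)
  then show "2 * (y - x) \<le> young_deriv y - young_deriv x" "young_deriv y - young_deriv x \<le> 6 * (y - x)" by auto
qed

lemma convex_young: "convex_on UNIV young"
  by (rule convex_on_realI[where f' = young_deriv])
     (use young_deriv_diff_bounds(1) in \<open>force intro: DERIV_young\<close>)+

text \<open>Slopes of \<open>young_deriv\<close> are at most 6, so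
  \<open>3 * x\<^sup>2 - young x\<close> is convex and lies above its tangents.\<close>

lemma young_add_le: "young (t + h) \<le> young t + young_deriv t * h + 3 * h\<^sup>2"
proof -
  have D: "DERIV (\<lambda>x. 3 * x\<^sup>2 - young x) x :> 6 * x - young_deriv x" for x
    by (auto intro!: derivative_eq_intros DERIV_young)
  have "convex_on UNIV (\<lambda>x. 3 * x\<^sup>2 - young x)"
    by (rule convex_on_realI[OF _ D]) (use young_deriv_diff_bounds(2) in \<open>force simp: algebra_simps\<close>)+
  then have "3 * (t + h)\<^sup>2 - young (t + h) - (3 * t\<^sup>2 - young t) \<ge> (6 * t - young_deriv t) * (t + h - t)"
    by (rule convex_on_imp_above_tangent) (use D in \<open>auto intro: has_field_derivative_at_within\<close>)
  then show ?thesis by (simp add: power2_eq_square algebra_simps)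
qed

section \<open>Oscillation along a circle\<close>

lemma abs_sin_ge: "\<bar>x\<bar> \<le> 2 \<Longrightarrow> \<bar>x\<bar> / 3 \<le> \<bar>sin x\<bar>" for x :: real
proof -
  assume x: "\<bar>x\<bar> \<le> 2"
  \<comment> \<open>The quadratic Taylor polynomial of \<open>sin\<close> is x itself; for |x| at
    most 2 the cubic remainder is at most 2 |x| / 3.\<close>
  have "(\<Sum>m<3. sin_coeff m * x ^ m) = x"
    by (simp add: sin_coeff_def numeral_3_eq_3)
  then have "\<bar>sin x - x\<bar> \<le> \<bar>x\<bar> ^ 3 / 6"
    using Maclaurin_sin_bound[of x 3] by (simp add: fact_numeral)
  moreover have "\<bar>x\<bar> ^ 3 \<le> 4 * \<bar>x\<bar>"
    using mult_right_mono[OF power_mono[OF x, of 2], of "\<bar>x\<bar>"] by (simp add: power2_eq_square power3_eq_cube)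
  ultimately show ?thesis by linarith
qed

text \<open>Since x / (1 + x) \<le> ln (1 + x) \<le> x, where both bounds share the sign of x and
  have size between |x| / 2 and 2 |x|, half the logarithm is comparable to x and in the range of
  \<open>abs_sin_ge\<close>.\<close>

lemma abs_sin_half_ln_ge:
  fixes x :: real
  assumes "\<bar>x\<bar> \<le> 1 / 2"
  shows "\<bar>x\<bar> / 24 \<le> \<bar>sin (ln (1 + x) / 2)\<bar>"
proof -
  have 1: "ln (1 + x) \<le> x"
    using assms by (intro ln_add_one_self_le_self2) auto
  have 2: "- ln (1 + x) \<le> - x / (1 + x)"
    using ln_le_minus_one[of "1 / (1 + x)"] assms by (simp add: ln_div field_simps)
  have 3: "\<bar>x\<bar> / 2 \<le> \<bar>x / (1 + x)\<bar>" "\<bar>x / (1 + x)\<bar> \<le> 2 * \<bar>x\<bar>"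
  proof -
    have "1 / 2 \<le> 1 + x" "1 + x \<le> 2" using assms by (auto simp: abs_le_iff)
    then have "1 / 2 \<le> 1 / (1 + x)" "1 / (1 + x) \<le> 2" by (auto simp: field_simps)
    then have "\<bar>x\<bar> * (1 / 2) \<le> \<bar>x\<bar> * (1 / (1 + x))" "\<bar>x\<bar> * (1 / (1 + x)) \<le> \<bar>x\<bar> * 2"
      by (intro mult_left_mono; simp)+
    then show "\<bar>x\<bar> / 2 \<le> \<bar>x / (1 + x)\<bar>" "\<bar>x / (1 + x)\<bar> \<le> 2 * \<bar>x\<bar>"
      using \<open>1 / 2 \<le> 1 + x\<close> by (simp_all add: abs_divide)
  qed
  have 4: "0 \<le> x \<longleftrightarrow> 0 \<le> x / (1 + x)"
    using assms by (auto simp: zero_le_divide_iff)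
  have "\<bar>x\<bar> / 4 \<le> \<bar>l / 2\<bar> \<and> \<bar>l / 2\<bar> \<le> 2"
    if "l \<le> x" "- l \<le> - q" "\<bar>x\<bar> / 2 \<le> \<bar>q\<bar>" "\<bar>q\<bar> \<le> 2 * \<bar>x\<bar>" "0 \<le> x \<longleftrightarrow> 0 \<le> q" for l q
    using that assms by linarith
  from this[OF 1 _ 3 4] 2 have "\<bar>x\<bar> / 4 \<le> \<bar>ln (1 + x) / 2\<bar> \<and> \<bar>ln (1 + x) / 2\<bar> \<le> 2"
    by simp
  then show ?thesis
    using abs_sin_ge[of "ln (1 + x) / 2"] by linarith
qed

text \<open>If \<open>sin\<close> is not small at a difference, it cannot nearly vanish at both
  ends. The next lemma is the analogue for zeros of \<open>cos\<close>.\<close>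

lemma abs_sin_diff_le_sin: "\<bar>sin (x - y)\<bar> \<le> \<bar>sin x\<bar> + \<bar>sin y\<bar>" for x y :: real
proof -
  have "\<bar>sin x * cos y\<bar> \<le> \<bar>sin x\<bar>" "\<bar>cos x * sin y\<bar> \<le> \<bar>sin y\<bar>"
    by (auto simp: abs_mult intro: mult_left_le mult_left_le_one_le)
  then show ?thesis unfolding sin_diff by linarith
qed

lemma abs_sin_diff_le_cos: "\<bar>sin (x - y)\<bar> \<le> \<bar>cos x\<bar> + \<bar>cos y\<bar>" for x y :: real
proof -
  have "\<bar>sin x * cos y\<bar> \<le> \<bar>cos y\<bar>" "\<bar>cos x * sin y\<bar> \<le> \<bar>cos x\<bar>"
    by (auto simp: abs_mult intro: mult_left_le mult_left_le_one_le)
  then show ?thesis unfolding sin_diff by linarith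
qed

lemma abs_cos_diff_le: "\<bar>cos x - cos y\<bar> \<le> \<bar>x - y\<bar>" for x y :: real
proof -
  have "\<bar>cos x - cos y\<bar> = 2 * \<bar>sin ((x + y) / 2)\<bar> * \<bar>sin ((y - x) / 2)\<bar>"
    by (simp add: cos_diff_cos abs_mult)
  also have "\<dots> \<le> 2 * 1 * \<bar>(y - x) / 2\<bar>"
    by (intro mult_mono abs_sin_x_le_abs_x) auto
  finally show ?thesis by simp
qed

lemma abs_sin_diff_le: "\<bar>sin x - sin y\<bar> \<le> \<bar>x - y\<bar>" for x y :: real
  using abs_cos_diff_le[of "pi / 2 - x" "pi / 2 - y"] by (simp add: cos_diff abs_minus_commute)

text \<open>Multiplicativity of the determinant: the matrix of the four cosines is the product of
  the matrix with rows (cos, sin) at \<theta>, \<theta>' and the one with columns (cos, sin) at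
  \<alpha>, \<beta>.\<close>

lemma cos_cross_diff:
  "cos (\<theta> - \<alpha>) * cos (\<theta>' - \<beta>) - cos (\<theta>' - \<alpha>) * cos (\<theta> - \<beta>) = sin (\<theta>' - \<theta>) * sin (\<beta> - \<alpha>)"
  for \<theta> :: real
proof -
  have "sin \<theta>^2 + cos \<theta>^2 = 1" by simp
  then show ?thesis
    by (simp add: cos_diff sin_diff) algebra
qed

text \<open>Product-to-sum splits each product into a part independent of the angle, which cancels,
  and a cosine of the doubled angle.\<close>

lemma cos_prod_diff:
  "cos (\<theta> - \<alpha>) * cos (\<theta> - \<beta>) - cos (\<theta>' - \<alpha>) * cos (\<theta>' - \<beta>) = sin (\<theta>' - \<theta>) * sin (\<theta> + \<theta>' - \<alpha> - \<beta>)"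
  for \<theta> :: real
proof -
  have "cos (\<theta> - \<alpha>) * cos (\<theta> - \<beta>) = (cos (\<beta> - \<alpha>) + cos (2 * \<theta> - \<alpha> - \<beta>)) / 2" for \<theta>
    by (simp add: cos_times_cos algebra_simps)
  then have "cos (\<theta> - \<alpha>) * cos (\<theta> - \<beta>) - cos (\<theta>' - \<alpha>) * cos (\<theta>' - \<beta>)
      = (cos (2 * \<theta> - \<alpha> - \<beta>) - cos (2 * \<theta>' - \<alpha> - \<beta>)) / 2"
    by simp
  also have "\<dots> = sin (\<theta> + \<theta>' - \<alpha> - \<beta>) * sin (\<theta>' - \<theta>)"
    unfolding cos_diff_cos by (simp add: algebra_simps diff_divide_distrib add_divide_distrib)
  finally show ?thesis by simp
qed

text \<open>The two sine arguments differ by ln (1 + x) / 2, where 1 + x is the ratio of the two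
  cosine quotients and x comes from \<open>cos_cross_diff\<close>. The radii r and s cancel, so the
  bound is independent of scale.\<close>

lemma ln_quotient_cos_oscillates:
  fixes r s \<theta> \<theta>' \<alpha> \<beta> :: real
  assumes rs: "r \<noteq> 0" "s \<noteq> 0"
    and c: "c > 0" "c \<le> \<bar>cos (\<theta> - \<alpha>)\<bar>" "c \<le> \<bar>cos (\<theta>' - \<alpha>)\<bar>" "c \<le> \<bar>cos (\<theta> - \<beta>)\<bar>" "c \<le> \<bar>cos (\<theta>' - \<beta>)\<bar>"
    and d: "\<bar>\<theta> - \<theta>'\<bar> \<le> c\<^sup>2 / 2"
  shows "\<bar>sin (\<theta> - \<theta>')\<bar> * \<bar>sin (\<alpha> - \<beta>)\<bar> / 24
    \<le> \<bar>sin ((ln (r * cos (\<theta> - \<alpha>)) - ln (s * cos (\<theta> - \<beta>))) / 2)\<bar>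
     + \<bar>sin ((ln (r * cos (\<theta>' - \<alpha>)) - ln (s * cos (\<theta>' - \<beta>))) / 2)\<bar>"
proof -
  define p q p' q' where "p = cos (\<theta> - \<alpha>)" "q = cos (\<theta> - \<beta>)" "p' = cos (\<theta>' - \<alpha>)" "q' = cos (\<theta>' - \<beta>)"
  note defs = this
  have nz: "p \<noteq> 0" "q \<noteq> 0" "p' \<noteq> 0" "q' \<noteq> 0" using c unfolding defs by auto
  define x where "x = sin (\<theta>' - \<theta>) * sin (\<beta> - \<alpha>) / (p' * q)"
  have "p * q' - p' * q = sin (\<theta>' - \<theta>) * sin (\<beta> - \<alpha>)"
    unfolding defs by (rule cos_cross_diff)
  then have x: "1 + x = p * q' / (p' * q)"
    unfolding x_def using nz by (simp add: field_simps)
  have pq: "c\<^sup>2 \<le> \<bar>p' * q\<bar>" "\<bar>p' * q\<bar> \<le> 1"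
    using c mult_mono[of c "\<bar>p'\<bar>" c "\<bar>q\<bar>"]
    by (auto simp: defs abs_mult power2_eq_square intro: mult_le_one)
  have absx: "\<bar>x\<bar> = \<bar>sin (\<theta> - \<theta>')\<bar> * \<bar>sin (\<alpha> - \<beta>)\<bar> / \<bar>p' * q\<bar>"
    unfolding x_def using sin_minus[of "\<theta> - \<theta>'"] sin_minus[of "\<alpha> - \<beta>"] by (simp add: abs_mult)
  have lower: "\<bar>sin (\<theta> - \<theta>')\<bar> * \<bar>sin (\<alpha> - \<beta>)\<bar> \<le> \<bar>x\<bar>"
    unfolding absx using pq nz by (simp add: pos_le_divide_eq mult_left_le)
  \<comment> \<open>The denominator of x is at least \<open>c\<^sup>2\<close>, so closeness of the
    angles brings x into the range of \<open>abs_sin_half_ln_ge\<close>.\<close>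
  have "\<bar>sin (\<theta> - \<theta>')\<bar> * \<bar>sin (\<alpha> - \<beta>)\<bar> \<le> \<bar>\<theta> - \<theta>'\<bar> * 1"
    by (intro mult_mono abs_sin_x_le_abs_x) auto
  also have "\<dots> \<le> c\<^sup>2 / 2" using d by simp
  also have "\<dots> \<le> 1 / 2 * \<bar>p' * q\<bar>" using pq by simp
  finally have upper: "\<bar>x\<bar> \<le> 1 / 2"
    unfolding absx using nz by (simp add: pos_divide_le_eq)
  have eq: "ln (1 + x) / 2 = (ln (r * p) - ln (s * q)) / 2 - (ln (r * p') - ln (s * q')) / 2"
    unfolding x using nz rs by (simp add: ln_mult ln_div field_simps)
  have "\<bar>sin (\<theta> - \<theta>')\<bar> * \<bar>sin (\<alpha> - \<beta>)\<bar> / 24 \<le> \<bar>x\<bar> / 24"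
    using lower by simp
  also have "\<dots> \<le> \<bar>sin (ln (1 + x) / 2)\<bar>"
    by (rule abs_sin_half_ln_ge[OF upper])
  also have "\<dots> \<le> \<bar>sin ((ln (r * p) - ln (s * q)) / 2)\<bar> + \<bar>sin ((ln (r * p') - ln (s * q')) / 2)\<bar>"
    unfolding eq by (rule abs_sin_diff_le_sin)
  finally show ?thesis
    unfolding defs .
qed

text \<open>The same argument for products, with \<open>cos_prod_diff\<close> and zeros of
  \<open>cos\<close>. The factor sin (\<theta> + \<theta>' - \<alpha> - \<beta>) is the reason why
  the base angle must also avoid zeros of sin (2 \<theta> - \<alpha> - \<beta>).\<close>

lemma ln_product_cos_oscillates:
  fixes r s \<theta> \<theta>' \<alpha> \<beta> :: real
  assumes rs: "r \<noteq> 0" "s \<noteq> 0"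
    and c: "c > 0" "c \<le> \<bar>cos (\<theta> - \<alpha>)\<bar>" "c \<le> \<bar>cos (\<theta>' - \<alpha>)\<bar>" "c \<le> \<bar>cos (\<theta> - \<beta>)\<bar>" "c \<le> \<bar>cos (\<theta>' - \<beta>)\<bar>"
    and d: "\<bar>\<theta> - \<theta>'\<bar> \<le> c\<^sup>2 / 2"
  shows "\<bar>sin (\<theta> - \<theta>')\<bar> * \<bar>sin (\<theta> + \<theta>' - \<alpha> - \<beta>)\<bar> / 24
    \<le> \<bar>cos ((ln (r * cos (\<theta> - \<alpha>)) + ln (s * cos (\<theta> - \<beta>))) / 2)\<bar>
     + \<bar>cos ((ln (r * cos (\<theta>' - \<alpha>)) + ln (s * cos (\<theta>' - \<beta>))) / 2)\<bar>"
proof -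
  define p q p' q' where "p = cos (\<theta> - \<alpha>)" "q = cos (\<theta> - \<beta>)" "p' = cos (\<theta>' - \<alpha>)" "q' = cos (\<theta>' - \<beta>)"
  note defs = this
  have nz: "p \<noteq> 0" "q \<noteq> 0" "p' \<noteq> 0" "q' \<noteq> 0" using c unfolding defs by auto
  define x where "x = sin (\<theta>' - \<theta>) * sin (\<theta> + \<theta>' - \<alpha> - \<beta>) / (p' * q')"
  have "p * q - p' * q' = sin (\<theta>' - \<theta>) * sin (\<theta> + \<theta>' - \<alpha> - \<beta>)"
    unfolding defs by (rule cos_prod_diff)
  then have x: "1 + x = p * q / (p' * q')"
    unfolding x_def using nz by (simp add: field_simps)
  have pq: "c\<^sup>2 \<le> \<bar>p' * q'\<bar>" "\<bar>p' * q'\<bar> \<le> 1"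
    using c mult_mono[of c "\<bar>p'\<bar>" c "\<bar>q'\<bar>"]
    by (auto simp: defs abs_mult power2_eq_square intro: mult_le_one)
  have absx: "\<bar>x\<bar> = \<bar>sin (\<theta> - \<theta>')\<bar> * \<bar>sin (\<theta> + \<theta>' - \<alpha> - \<beta>)\<bar> / \<bar>p' * q'\<bar>"
    unfolding x_def using sin_minus[of "\<theta> - \<theta>'"] by (simp add: abs_mult)
  have lower: "\<bar>sin (\<theta> - \<theta>')\<bar> * \<bar>sin (\<theta> + \<theta>' - \<alpha> - \<beta>)\<bar> \<le> \<bar>x\<bar>"
    unfolding absx using pq nz by (simp add: pos_le_divide_eq mult_left_le)
  have "\<bar>sin (\<theta> - \<theta>')\<bar> * \<bar>sin (\<theta> + \<theta>' - \<alpha> - \<beta>)\<bar> \<le> \<bar>\<theta> - \<theta>'\<bar> * 1"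
    by (intro mult_mono abs_sin_x_le_abs_x) auto
  also have "\<dots> \<le> c\<^sup>2 / 2" using d by simp
  also have "\<dots> \<le> 1 / 2 * \<bar>p' * q'\<bar>" using pq by simp
  finally have upper: "\<bar>x\<bar> \<le> 1 / 2"
    unfolding absx using nz by (simp add: pos_divide_le_eq)
  have eq: "ln (1 + x) / 2 = (ln (r * p) + ln (s * q)) / 2 - (ln (r * p') + ln (s * q')) / 2"
    unfolding x using nz rs by (simp add: ln_mult ln_div field_simps)
  have "\<bar>sin (\<theta> - \<theta>')\<bar> * \<bar>sin (\<theta> + \<theta>' - \<alpha> - \<beta>)\<bar> / 24 \<le> \<bar>x\<bar> / 24"
    using lower by simp
  also have "\<dots> \<le> \<bar>sin (ln (1 + x) / 2)\<bar>"
    by (rule abs_sin_half_ln_ge[OF upper])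
  also have "\<dots> \<le> \<bar>cos ((ln (r * p) + ln (s * q)) / 2)\<bar> + \<bar>cos ((ln (r * p') + ln (s * q')) / 2)\<bar>"
    unfolding eq by (rule abs_sin_diff_le_cos)
  finally show ?thesis
    unfolding defs .
qed

text \<open>Each of the three conditions fails for at most one of the four angles.\<close>
lemma exists_angle_away_from_zeros:
  fixes \<alpha> \<beta> :: real
  shows "\<exists>k<4. 1 / 20 \<le> \<bar>cos (real k / 3 - \<alpha>)\<bar> \<and> 1 / 20 \<le> \<bar>cos (real k / 3 - \<beta>)\<bar>
    \<and> 1 / 20 \<le> \<bar>sin (2 * (real k / 3) - \<alpha> - \<beta>)\<bar>"
proof (rule ccontr)
  assume none: "\<not> ?thesis"
  define bad :: "nat \<Rightarrow> nat \<Rightarrow> bool" where "bad m k \<longleftrightarrow>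
      (if m = 0 then \<bar>cos (real k / 3 - \<alpha>)\<bar> else if m = 1 then \<bar>cos (real k / 3 - \<beta>)\<bar>
       else \<bar>sin (2 * (real k / 3) - \<alpha> - \<beta>)\<bar>) < 1 / 20" for m k
  have unique: "k = l" if kl: "k < 4" "l < 4" and b: "bad m k" "bad m l" for m k l
  proof (rule ccontr)
    assume "k \<noteq> l"
    \<comment> \<open>Spacing 1/3 with four angles keeps even the doubled differences at most 2, the
      range of \<open>abs_sin_ge\<close>. The resulting 1/9 exceeds 1/20 + 1/20.\<close>
    have sep: "1 / 3 \<le> \<bar>real k / 3 - real l / 3\<bar>" "\<bar>real k / 3 - real l / 3\<bar> \<le> 1"
      using kl \<open>k \<noteq> l\<close> by (auto simp: abs_if)
    have s1: "1 / 9 \<le> \<bar>sin (real k / 3 - real l / 3)\<bar>"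
      using order_trans[OF _ abs_sin_ge[of "real k / 3 - real l / 3"], of "1 / 9"] sep by simp
    have d: "\<bar>2 * (real k / 3) - 2 * (real l / 3)\<bar> = 2 * \<bar>real k / 3 - real l / 3\<bar>"
      unfolding right_diff_distrib[symmetric] abs_mult by simp
    have s2: "1 / 9 \<le> \<bar>sin (2 * (real k / 3) - 2 * (real l / 3))\<bar>"
      by (rule order_trans[OF _ abs_sin_ge]) (use sep in \<open>simp_all only: d, simp_all\<close>)
    have contra: False if "1 / 9 \<le> x" "x \<le> p + q" "p < 1 / 20" "q < 1 / 20" for x p q :: real
      using that by linarith
    have cos_le: "\<bar>sin (real k / 3 - real l / 3)\<bar> \<le> \<bar>cos (real k / 3 - \<gamma>)\<bar> + \<bar>cos (real l / 3 - \<gamma>)\<bar>" for \<gamma>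
      using abs_sin_diff_le_cos[of "real k / 3 - \<gamma>" "real l / 3 - \<gamma>"] by simp
    have sin_le: "\<bar>sin (2 * (real k / 3) - 2 * (real l / 3))\<bar>
        \<le> \<bar>sin (2 * (real k / 3) - \<alpha> - \<beta>)\<bar> + \<bar>sin (2 * (real l / 3) - \<alpha> - \<beta>)\<bar>"
      using abs_sin_diff_le_sin[of "2 * (real k / 3) - \<alpha> - \<beta>" "2 * (real l / 3) - \<alpha> - \<beta>"] by simp
    consider "m = 0" | "m = 1" | "m \<noteq> 0" "m \<noteq> 1" by blast
    then show False
    proof cases
      case 1
      show False by (rule contra[OF s1 cos_le[of \<alpha>]]) (use b 1 in \<open>simp_all add: bad_def\<close>)
    next
      case 2
      show False by (rule contra[OF s1 cos_le[of \<beta>]]) (use b 2 in \<open>simp_all add: bad_def\<close>)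
    next
      case 3
      show False by (rule contra[OF s2 sin_le]) (use b 3 in \<open>simp_all add: bad_def\<close>)
    qed
  qed
  have "\<exists>m<3. bad m k" if "k < 4" for k
  proof -
    have "bad 0 k \<or> bad 1 k \<or> bad 2 k"
      using none that by (auto simp: bad_def not_le)
    moreover have "(0::nat) < 3" "(1::nat) < 3" "(2::nat) < 3" by auto
    ultimately show ?thesis by blast
  qed
  then obtain m where m: "\<And>k. k < 4 \<Longrightarrow> m k < 3 \<and> bad (m k) k" by metis
  have "inj_on m {..<4}"
    by (rule inj_onI) (metis m unique lessThan_iff)
  moreover have "m ` {..<4} \<subseteq> {..<3::nat}" using m by auto
  ultimately have "card {..<4::nat} \<le> card {..<3::nat}" by (intro card_inj_on_le) auto
  then show False by simp
qed


text \<open>Pigeonhole: each property rules out at most one of three indices, so one index survives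
  both.\<close>

lemma majority_index:
  fixes P Q :: "nat \<Rightarrow> bool"
  assumes P: "\<And>i j. i < 3 \<Longrightarrow> j < 3 \<Longrightarrow> i \<noteq> j \<Longrightarrow> P i \<or> P j"
    and Q: "\<And>i j. i < 3 \<Longrightarrow> j < 3 \<Longrightarrow> i \<noteq> j \<Longrightarrow> Q i \<or> Q j"
  shows "\<exists>j<3. P j \<and> Q j"
proof -
  have "P 0 \<or> P 1" "P 0 \<or> P 2" "P 1 \<or> P 2" "Q 0 \<or> Q 1" "Q 0 \<or> Q 2" "Q 1 \<or> Q 2"
    using P Q by simp_all
  then consider "P 0 \<and> Q 0" | "P 1 \<and> Q 1" | "P 2 \<and> Q 2" by blast
  then show ?thesis by cases (force intro: exI[of _ "0::nat"] exI[of _ "1::nat"] exI[of _ "2::nat"])+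
qed

text \<open>Among the three angles near the base angle, at most one fails the lower bound for \<open>sin (A \<theta>)\<close>
  and at most one that for \<open>cos (B \<theta>)\<close>.\<close>
lemma exists_oscillation_angle:
  fixes \<alpha> \<beta> r s :: real
  assumes rs: "r \<noteq> 0" "s \<noteq> 0"
  defines "h \<equiv> 1 / 6400"
  defines "A \<equiv> \<lambda>\<theta>. (ln (r * cos (\<theta> - \<alpha>)) - ln (s * cos (\<theta> - \<beta>))) / 2"
  defines "B \<equiv> \<lambda>\<theta>. (ln (r * cos (\<theta> - \<alpha>)) + ln (s * cos (\<theta> - \<beta>))) / 2"
  shows "\<exists>k<4. \<exists>j<3. let \<theta> = real k / 3 + real j * h in
    1 / 40 \<le> \<bar>cos (\<theta> - \<alpha>)\<bar> \<and> 1 / 40 \<le> \<bar>cos (\<theta> - \<beta>)\<bar> \<and>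
    h / 144 * \<bar>sin (\<alpha> - \<beta>)\<bar> \<le> \<bar>sin (A \<theta>)\<bar> \<and> h / 144 / 40 \<le> \<bar>cos (B \<theta>)\<bar>"
proof -
  obtain k where "k < 4" and k: "1 / 20 \<le> \<bar>cos (real k / 3 - \<alpha>)\<bar>" "1 / 20 \<le> \<bar>cos (real k / 3 - \<beta>)\<bar>"
    "1 / 20 \<le> \<bar>sin (2 * (real k / 3) - \<alpha> - \<beta>)\<bar>"
    using exists_angle_away_from_zeros[of \<alpha> \<beta>] by auto
  define \<theta> where "\<theta> j = real k / 3 + real j * h" for j
  \<comment> \<open>Shifts are at most 2 h, so the Lipschitz bound costs at most half of 1/20;
    \<open>sin_ge\<close> below is similar.\<close>
  have cos_ge: "1 / 40 \<le> \<bar>cos (\<theta> j - \<gamma>)\<bar>" if "j < 3" "1 / 20 \<le> \<bar>cos (real k / 3 - \<gamma>)\<bar>" for j \<gamma>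
  proof -
    have "\<bar>(\<theta> j - \<gamma>) - (real k / 3 - \<gamma>)\<bar> \<le> 1 / 40"
      using that by (simp add: \<theta>_def h_def)
    then show ?thesis
      using that abs_cos_diff_le[of "\<theta> j - \<gamma>" "real k / 3 - \<gamma>"] by linarith
  qed
  have sin_ge: "1 / 40 \<le> \<bar>sin (\<theta> i + \<theta> j - \<alpha> - \<beta>)\<bar>" if "i < 3" "j < 3" for i j
  proof -
    have "\<bar>(\<theta> i + \<theta> j - \<alpha> - \<beta>) - (2 * (real k / 3) - \<alpha> - \<beta>)\<bar> \<le> 1 / 40"
      using that by (simp add: \<theta>_def h_def)
    then show ?thesis
      using k(3) abs_sin_diff_le[of "\<theta> i + \<theta> j - \<alpha> - \<beta>" "2 * (real k / 3) - \<alpha> - \<beta>"] by linarith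
  qed
  \<comment> \<open>The value of h makes 2 h equal to \<open>(1 / 40)\<^sup>2 / 2\<close>, the
    distance that the oscillation lemmas allow for c = 1/40.\<close>
  have sep: "\<bar>\<theta> i - \<theta> j\<bar> \<le> (1 / 40)\<^sup>2 / 2 \<and> h / 3 \<le> \<bar>sin (\<theta> i - \<theta> j)\<bar>"
    if "i < 3" "j < 3" "i \<noteq> j" for i j
  proof -
    have "\<theta> i - \<theta> j = (real i - real j) * h" by (simp add: \<theta>_def algebra_simps)
    then have "\<bar>\<theta> i - \<theta> j\<bar> = \<bar>real i - real j\<bar> * h"
      by (simp only: abs_mult) (simp add: h_def)
    moreover have "1 \<le> \<bar>real i - real j\<bar>" "\<bar>real i - real j\<bar> \<le> 2"
      using that by (auto simp: abs_if)
    ultimately have b: "h \<le> \<bar>\<theta> i - \<theta> j\<bar>" "\<bar>\<theta> i - \<theta> j\<bar> \<le> 2 * h"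
      by (auto simp: h_def)
    have "h / 3 \<le> \<bar>\<theta> i - \<theta> j\<bar> / 3" using b by simp
    also have "\<dots> \<le> \<bar>sin (\<theta> i - \<theta> j)\<bar>" using b by (intro abs_sin_ge) (simp add: h_def)
    finally show ?thesis using b by (simp add: h_def power2_eq_square)
  qed
  \<comment> \<open>The two values add up to at least h / 3 / 24 times |sin (\<alpha> - \<beta>)|;
    half of this is the threshold with h / 144. The same halving gives the threshold in
    \<open>B\<close>.\<close>
  have A: "\<not> (\<bar>sin (A (\<theta> i))\<bar> < h / 144 * \<bar>sin (\<alpha> - \<beta>)\<bar> \<and> \<bar>sin (A (\<theta> j))\<bar> < h / 144 * \<bar>sin (\<alpha> - \<beta>)\<bar>)"
    if "i < 3" "j < 3" "i \<noteq> j" for i j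
  proof -
    have "h / 3 * \<bar>sin (\<alpha> - \<beta>)\<bar> / 24 \<le> \<bar>sin (\<theta> i - \<theta> j)\<bar> * \<bar>sin (\<alpha> - \<beta>)\<bar> / 24"
      using sep[OF that] by (intro divide_right_mono mult_right_mono) auto
    also have "\<dots> \<le> \<bar>sin (A (\<theta> i))\<bar> + \<bar>sin (A (\<theta> j))\<bar>"
      unfolding A_def using cos_ge k that sep[OF that]
      by (intro ln_quotient_cos_oscillates[OF rs, of "1 / 40"]) auto
    finally show ?thesis by auto
  qed
  have B: "\<not> (\<bar>cos (B (\<theta> i))\<bar> < h / 144 / 40 \<and> \<bar>cos (B (\<theta> j))\<bar> < h / 144 / 40)"
    if "i < 3" "j < 3" "i \<noteq> j" for i j
  proof -
    have "h / 3 * (1 / 40) / 24 \<le> \<bar>sin (\<theta> i - \<theta> j)\<bar> * \<bar>sin (\<theta> i + \<theta> j - \<alpha> - \<beta>)\<bar> / 24"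
      using sep[OF that] sin_ge that by (intro divide_right_mono mult_mono) auto
    also have "\<dots> \<le> \<bar>cos (B (\<theta> i))\<bar> + \<bar>cos (B (\<theta> j))\<bar>"
      unfolding B_def using cos_ge k that sep[OF that]
      by (intro ln_product_cos_oscillates[OF rs, of "1 / 40"]) auto
    finally show ?thesis by auto
  qed
  have "\<exists>j<3. h / 144 * \<bar>sin (\<alpha> - \<beta>)\<bar> \<le> \<bar>sin (A (\<theta> j))\<bar> \<and> h / 144 / 40 \<le> \<bar>cos (B (\<theta> j))\<bar>"
    using A B by (intro majority_index) (auto simp: not_less)
  then show ?thesis
    using \<open>k < 4\<close> cos_ge k unfolding Let_def \<theta>_def by blast
qed

section \<open>Oscillation sampled at finitely many angles\<close>

definition test_angles :: "real set" where
  "test_angles = (\<lambda>(k, j). real k / 3 + real j * (1 / 6400)) ` ({..<4} \<times> {..<3::nat})"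

lemma finite_test_angles: "finite test_angles"
  by (simp add: test_angles_def)

text \<open>The determinant measuring how far (\<open>young_deriv a\<close>,
  \<open>young_deriv b\<close>) is from being parallel to (a, b).\<close>

definition crossed :: "real \<Rightarrow> real \<Rightarrow> real" where
  "crossed a b = young_deriv a * b - young_deriv b * a"

text \<open>The constant 4 in \<open>young_deriv\<close> cancels. Sum-to-product leaves the half
  difference and half sum of logarithms treated by the oscillation lemmas.\<close>

lemma crossed_eq:
  fixes a b :: real
  assumes "a \<noteq> 0" "b \<noteq> 0"
  shows "crossed a b = 2 * (a * b) * (sin ((ln a - ln b) / 2) * cos ((ln a + ln b) / 2))"
proof -
  have "crossed a b = a * b * (sin (ln a) - sin (ln b))"
    by (simp add: crossed_def young_deriv_def algebra_simps)
  then show ?thesis by (simp add: sin_diff_sin)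
qed

text \<open>In polar form the determinant on the left is r s sin (\<beta> - \<alpha>), and some test
  angle makes \<open>crossed\<close> at least a fixed multiple of it. That angle depends on the
  coordinates; summing over all test angles removes the dependence.\<close>

lemma young_deriv_transversal:
  "\<exists>\<kappa>>0. \<forall>a a' b b'. \<kappa> * (a * b' - a' * b)\<^sup>2 \<le>
      (\<Sum>\<theta>\<in>test_angles. (crossed (cos \<theta> * a + sin \<theta> * a') (cos \<theta> * b + sin \<theta> * b'))\<^sup>2)"
proof -
  define h :: real where "h = 1 / 6400"
  \<comment> \<open>2 comes from \<open>crossed_eq\<close>, the square from the two cosines, the
    rest from the thresholds for \<open>sin\<close> and \<open>cos\<close>.\<close>
  define c where "c = 2 * (1 / 40)\<^sup>2 * (h / 144 * (h / 144 / 40))"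
  have "c\<^sup>2 > 0" by (simp add: c_def h_def)
  moreover have "c\<^sup>2 * (a * b' - a' * b)\<^sup>2 \<le>
      (\<Sum>\<theta>\<in>test_angles. (crossed (cos \<theta> * a + sin \<theta> * a') (cos \<theta> * b + sin \<theta> * b'))\<^sup>2)" for a a' b b'
  proof -
    let ?D = "\<lambda>\<theta>. crossed (cos \<theta> * a + sin \<theta> * a') (cos \<theta> * b + sin \<theta> * b')"
    obtain r \<alpha> where a: "a = r * cos \<alpha>" "a' = r * sin \<alpha>" using polar_Ex by blast
    obtain s \<beta> where b: "b = s * cos \<beta>" "b' = s * sin \<beta>" using polar_Ex by blast
    have det: "a * b' - a' * b = r * s * sin (\<beta> - \<alpha>)"
      by (simp add: a b sin_diff algebra_simps)
    show ?thesis
    proof (cases "r = 0 \<or> s = 0")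
      case True
      then show ?thesis unfolding det by (auto intro!: sum_nonneg)
    next
      case False
      then obtain k j where kj: "k < 4" "j < 3" and
        *: "let \<theta> = real k / 3 + real j * h in
          1 / 40 \<le> \<bar>cos (\<theta> - \<alpha>)\<bar> \<and> 1 / 40 \<le> \<bar>cos (\<theta> - \<beta>)\<bar> \<and>
          h / 144 * \<bar>sin (\<alpha> - \<beta>)\<bar> \<le> \<bar>sin ((ln (r * cos (\<theta> - \<alpha>)) - ln (s * cos (\<theta> - \<beta>))) / 2)\<bar> \<and>
          h / 144 / 40 \<le> \<bar>cos ((ln (r * cos (\<theta> - \<alpha>)) + ln (s * cos (\<theta> - \<beta>))) / 2)\<bar>"
        using exists_oscillation_angle[of r s \<alpha> \<beta>] unfolding h_def by blast
      define \<theta> where "\<theta> = real k / 3 + real j * h"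
      note * = *[unfolded Let_def, folded \<theta>_def]
      have "\<theta> \<in> test_angles" using kj by (auto simp: test_angles_def \<theta>_def h_def)
      have ab: "cos \<theta> * a + sin \<theta> * a' = r * cos (\<theta> - \<alpha>)" "cos \<theta> * b + sin \<theta> * b' = s * cos (\<theta> - \<beta>)"
        by (simp_all add: a b cos_diff algebra_simps)
      have "c * \<bar>a * b' - a' * b\<bar> = 2 * (\<bar>r\<bar> * (1 / 40) * (\<bar>s\<bar> * (1 / 40))) * (h / 144 * \<bar>sin (\<alpha> - \<beta>)\<bar> * (h / 144 / 40))"
        using sin_minus[of "\<alpha> - \<beta>"] by (simp add: det c_def abs_mult power2_eq_square)
      also have "\<dots> \<le> 2 * (\<bar>r * cos (\<theta> - \<alpha>)\<bar> * \<bar>s * cos (\<theta> - \<beta>)\<bar>) *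
          (\<bar>sin ((ln (r * cos (\<theta> - \<alpha>)) - ln (s * cos (\<theta> - \<beta>))) / 2)\<bar>
         * \<bar>cos ((ln (r * cos (\<theta> - \<alpha>)) + ln (s * cos (\<theta> - \<beta>))) / 2)\<bar>)"
        unfolding abs_mult using * by (intro mult_mono) (auto simp: h_def)
      also have "\<dots> = \<bar>?D \<theta>\<bar>"
        unfolding ab using * False by (subst crossed_eq) (auto simp: abs_mult)
      finally have "(c * \<bar>a * b' - a' * b\<bar>)\<^sup>2 \<le> \<bar>?D \<theta>\<bar>\<^sup>2"
        by (rule power_mono) (simp add: c_def h_def)
      then have "c\<^sup>2 * (a * b' - a' * b)\<^sup>2 \<le> (?D \<theta>)\<^sup>2"
        by (simp add: power_mult_distrib)
      also have "\<dots> \<le> (\<Sum>\<theta>\<in>test_angles. (?D \<theta>)\<^sup>2)"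
        using \<open>\<theta> \<in> test_angles\<close> finite_test_angles by (intro member_le_sum) auto
      finally show ?thesis .
    qed
  qed
  ultimately show ?thesis by blast
qed

section \<open>The Orlicz norm\<close>

abbreviation coord :: "(nat \<Rightarrow>\<^sub>0 real) \<Rightarrow> nat \<Rightarrow> real" where
  "coord \<equiv> Poly_Mapping.lookup"

definition orlicz_sum :: "nat \<Rightarrow> (nat \<Rightarrow>\<^sub>0 real) \<Rightarrow> real" where
  "orlicz_sum n x = (\<Sum>i<n. young (coord x i))"

text \<open>The Luxemburg gauge of the set where the Orlicz sum is at most 1.\<close>

definition orlicz_norm :: "nat \<Rightarrow> (nat \<Rightarrow>\<^sub>0 real) \<Rightarrow> real" where
  "orlicz_norm n x = Inf {l. 0 < l \<and> orlicz_sum n (inverse l *\<^sub>R x) \<le> 1}"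

lemma std_inner_Rn: "x \<in> Rn n \<Longrightarrow> std_inner x y = (\<Sum>i<n. coord x i * coord y i)"
  by (rule std_inner_eq) (auto simp: Rn_def)

lemma std_norm_power2: "(std_norm x)\<^sup>2 = std_inner x x"
  by (simp add: std_norm_eq_sqrt_inner std_inner_def sum_nonneg)

lemma std_norm_nonneg [simp]: "0 \<le> std_norm x"
  by (simp add: std_norm_def)

lemma std_norm_eq_0 [simp]: "std_norm x = 0 \<longleftrightarrow> x = 0"
  by (simp add: std_norm_eq_sqrt_inner std_inner_self_eq_0)

lemma std_norm_scaleR: "std_norm (c *\<^sub>R x) = \<bar>c\<bar> * std_norm x"
  by (simp add: std_norm_eq_sqrt_inner std_inner_scaleR_left std_inner_scaleR_right
      real_sqrt_mult flip: mult.assoc)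

lemma std_norm_power2_Rn: "x \<in> Rn n \<Longrightarrow> (std_norm x)\<^sup>2 = (\<Sum>i<n. (coord x i)\<^sup>2)"
  unfolding std_norm_power2 by (simp add: std_inner_Rn power2_eq_square)

lemma orlicz_sum_bounds:
  assumes "x \<in> Rn n"
  shows "(std_norm x)\<^sup>2 \<le> orlicz_sum n x" "orlicz_sum n x \<le> 4 * (std_norm x)\<^sup>2"
  by (auto simp: std_norm_power2_Rn[OF assms] orlicz_sum_def sum_distrib_left intro!: sum_mono young_bounds)

lemma orlicz_sum_convex:
  assumes "0 \<le> u" "u \<le> 1"
  shows "orlicz_sum n ((1 - u) *\<^sub>R x + u *\<^sub>R y) \<le> (1 - u) * orlicz_sum n x + u * orlicz_sum n y"
  unfolding orlicz_sum_def sum_distrib_left sum.distrib[symmetric]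
  using convex_onD[OF convex_young assms]
  by (intro sum_mono) (simp add: lookup_add lookup_scaleR)

text \<open>Convexity on the segment from 0, where the Orlicz sum is 0. It makes the admissible l in
  \<open>orlicz_norm\<close> upward closed.\<close>

lemma orlicz_sum_scale_le_1:
  assumes "0 \<le> u" "u \<le> 1" "orlicz_sum n x \<le> 1"
  shows "orlicz_sum n (u *\<^sub>R x) \<le> 1"
proof -
  have "orlicz_sum n (u *\<^sub>R x) \<le> u * orlicz_sum n x"
    using orlicz_sum_convex[OF assms(1,2), of n 0 x] by (simp add: orlicz_sum_def)
  also have "\<dots> \<le> 1" using mult_left_mono[OF assms(3,1)] assms(2) by simp
  finally show ?thesis .
qed

lemma orlicz_norm_le: "0 < l \<Longrightarrow> orlicz_sum n (inverse l *\<^sub>R x) \<le> 1 \<Longrightarrow> orlicz_norm n x \<le> l"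
  unfolding orlicz_norm_def by (intro cInf_lower bdd_belowI[of _ 0]) auto

text \<open>The bound \<open>young t \<le> 4 * t\<^sup>2\<close> controls the sum. This also shows
  that the infimum runs over a nonempty set.\<close>

lemma orlicz_feasible:
  assumes "x \<in> Rn n" "0 < l" "2 * std_norm x \<le> l"
  shows "orlicz_sum n (inverse l *\<^sub>R x) \<le> 1"
proof -
  have "inverse l *\<^sub>R x \<in> Rn n" using assms subspace_scale[OF subspace_Rn] by blast
  then have "orlicz_sum n (inverse l *\<^sub>R x) \<le> (2 * (std_norm x / l))\<^sup>2"
    using orlicz_sum_bounds(2) assms
    by (fastforce simp: std_norm_scaleR power_mult_distrib divide_inverse mult.commute)
  also have "\<dots> \<le> 1\<^sup>2" using assms by (intro power_mono) auto
  finally show ?thesis by simp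
qed

text \<open>Some admissible value lies below l, and admissibility passes upwards by scaling.
  Strictness avoids asking whether the infimum is attained.\<close>

lemma orlicz_sum_le_1:
  assumes x: "x \<in> Rn n" and l: "orlicz_norm n x < l"
  shows "orlicz_sum n (inverse l *\<^sub>R x) \<le> 1"
proof -
  let ?S = "{l. 0 < l \<and> orlicz_sum n (inverse l *\<^sub>R x) \<le> 1}"
  \<comment> \<open>The summand 1 keeps the witness positive at x = 0.\<close>
  have "2 * std_norm x + 1 \<in> ?S"
    using x by (auto intro!: orlicz_feasible add_nonneg_pos)
  then obtain m where m: "0 < m" "orlicz_sum n (inverse m *\<^sub>R x) \<le> 1" "m < l"
    using l cInf_lessD[of ?S l] unfolding orlicz_norm_def by blast
  have "orlicz_sum n ((m / l) *\<^sub>R (inverse m *\<^sub>R x)) \<le> 1"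
    by (rule orlicz_sum_scale_le_1) (use m in auto)
  moreover have "(m / l) *\<^sub>R (inverse m *\<^sub>R x) = inverse l *\<^sub>R x"
  proof -
    have "m / l * inverse m = inverse l" using m by (simp add: field_simps)
    then show ?thesis by (simp only: scaleR_scaleR)
  qed
  ultimately show ?thesis by (simp only:)
qed

lemma orlicz_norm_bounds:
  assumes x: "x \<in> Rn n"
  shows "std_norm x \<le> orlicz_norm n x" "orlicz_norm n x \<le> 2 * std_norm x"
proof -
  let ?S = "{l. 0 < l \<and> orlicz_sum n (inverse l *\<^sub>R x) \<le> 1}"
  have ne: "2 * std_norm x + 1 \<in> ?S"
    using x by (auto intro!: orlicz_feasible add_nonneg_pos)
  show "std_norm x \<le> orlicz_norm n x"
    unfolding orlicz_norm_def
  proof (rule cInf_greatest)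
    show "?S \<noteq> {}" using ne by blast
  next
    fix l assume l: "l \<in> ?S"
    have "inverse l *\<^sub>R x \<in> Rn n" using x subspace_scale[OF subspace_Rn] by blast
    then have "(std_norm (inverse l *\<^sub>R x))\<^sup>2 \<le> 1\<^sup>2"
      using orlicz_sum_bounds(1) l by fastforce
    then have "std_norm (inverse l *\<^sub>R x) \<le> 1" by (rule power2_le_imp_le) simp
    then show "std_norm x \<le> l" using l by (simp add: std_norm_scaleR field_simps)
  qed
  show "orlicz_norm n x \<le> 2 * std_norm x"
  proof (rule field_le_epsilon)
    fix e :: real assume "0 < e"
    then show "orlicz_norm n x \<le> 2 * std_norm x + e"
      using x by (intro orlicz_norm_le orlicz_feasible add_nonneg_pos) auto
  qed
qed

text \<open>Evenness of \<open>young\<close> handles negative c. Equality follows later by a second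
  application with \<open>inverse c\<close>.\<close>

lemma orlicz_norm_scaleR_le:
  assumes x: "x \<in> Rn n" and c: "c \<noteq> 0"
  shows "orlicz_norm n (c *\<^sub>R x) \<le> \<bar>c\<bar> * orlicz_norm n x"
proof (rule field_le_epsilon)
  fix e :: real assume e: "0 < e"
  define l where "l = orlicz_norm n x + e / \<bar>c\<bar>"
  have l: "orlicz_norm n x < l" "0 < l"
    using e c orlicz_norm_bounds(1)[OF x] std_norm_nonneg[of x]
    by (auto simp: l_def intro!: add_nonneg_pos simp del: std_norm_nonneg)
  have "orlicz_sum n (inverse (\<bar>c\<bar> * l) *\<^sub>R c *\<^sub>R x) = orlicz_sum n (inverse l *\<^sub>R x)"
  proof (cases "c > 0")
    case True
    then have "inverse (\<bar>c\<bar> * l) * c = inverse l" using l by (simp add: field_simps)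
    then show ?thesis by (simp only: scaleR_scaleR)
  next
    case False
    then have "inverse (\<bar>c\<bar> * l) *\<^sub>R c *\<^sub>R x = (- inverse l) *\<^sub>R x" using c by simp
    then show ?thesis by (simp add: orlicz_sum_def lookup_scaleR)
  qed
  then have "orlicz_norm n (c *\<^sub>R x) \<le> \<bar>c\<bar> * l"
    using orlicz_sum_le_1[OF x l(1)] l c by (intro orlicz_norm_le) auto
  also have "\<dots> = \<bar>c\<bar> * orlicz_norm n x + e"
    using c by (simp add: l_def distrib_left)
  finally show "orlicz_norm n (c *\<^sub>R x) \<le> \<bar>c\<bar> * orlicz_norm n x + e" .
qed

lemma orlicz_norm_scaleR:
  assumes x: "x \<in> Rn n"
  shows "orlicz_norm n (c *\<^sub>R x) = \<bar>c\<bar> * orlicz_norm n x"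
proof (cases "c = 0")
  case True
  have "0 \<in> Rn n" by (simp add: Rn_def)
  then have "orlicz_norm n 0 = 0"
    using orlicz_norm_bounds[of 0 n] std_norm_eq_0[of 0]
    by (metis mult_zero_right order_antisym)
  then show ?thesis using True by simp
next
  case False
  have "c *\<^sub>R x \<in> Rn n" using x subspace_scale[OF subspace_Rn] by blast
  from orlicz_norm_scaleR_le[OF this, of "inverse c"] False
  have "\<bar>c\<bar> * orlicz_norm n x \<le> orlicz_norm n (c *\<^sub>R x)" by (simp add: field_simps)
  then show ?thesis using orlicz_norm_scaleR_le[OF x False] by simp
qed

lemma orlicz_norm_triangle:
  assumes x: "x \<in> Rn n" and y: "y \<in> Rn n"
  shows "orlicz_norm n (x + y) \<le> orlicz_norm n x + orlicz_norm n y"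
proof (rule field_le_epsilon)
  fix e :: real assume e: "0 < e"
  define l m where "l = orlicz_norm n x + e / 2" and "m = orlicz_norm n y + e / 2"
  have pos: "0 < l" "0 < m"
    using e order_trans[OF std_norm_nonneg orlicz_norm_bounds(1)] x y
    by (auto simp: l_def m_def intro!: add_nonneg_pos)
  have S: "orlicz_sum n (inverse l *\<^sub>R x) \<le> 1" "orlicz_sum n (inverse m *\<^sub>R y) \<le> 1"
    using e by (auto simp: l_def m_def intro!: orlicz_sum_le_1 x y)
  \<comment> \<open>With this weight (x + y) / (l + m) is a convex combination of x / l and y /
    m.\<close>
  define u where "u = m / (l + m)"
  have u: "0 \<le> u" "u \<le> 1" using pos by (auto simp: u_def)
  have "inverse (l + m) *\<^sub>R (x + y) = (1 - u) *\<^sub>R (inverse l *\<^sub>R x) + u *\<^sub>R (inverse m *\<^sub>R y)"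
  proof -
    have "(1 - u) * inverse l = inverse (l + m)" "u * inverse m = inverse (l + m)"
      using pos by (auto simp: u_def field_simps)
    then show ?thesis by (simp add: scaleR_add_right)
  qed
  then have "orlicz_sum n (inverse (l + m) *\<^sub>R (x + y))
      \<le> (1 - u) * orlicz_sum n (inverse l *\<^sub>R x) + u * orlicz_sum n (inverse m *\<^sub>R y)"
    using orlicz_sum_convex[OF u, of n "inverse l *\<^sub>R x" "inverse m *\<^sub>R y"] by simp
  also have "\<dots> \<le> (1 - u) * 1 + u * 1"
    using u S by (intro add_mono mult_left_mono) auto
  finally have "orlicz_norm n (x + y) \<le> l + m"
    using pos by (intro orlicz_norm_le) auto
  then show "orlicz_norm n (x + y) \<le> orlicz_norm n x + orlicz_norm n y + e"
    by (simp add: l_def m_def)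
qed

lemma norm_on_orlicz_norm: "norm_on (Rn n) (orlicz_norm n)"
  unfolding norm_on_def
proof (intro conjI ballI allI)
  fix x assume x: "x \<in> Rn n"
  show "0 \<le> orlicz_norm n x"
    using order_trans[OF std_norm_nonneg orlicz_norm_bounds(1)[OF x]] .
  show "orlicz_norm n x = 0 \<longleftrightarrow> x = 0"
    using orlicz_norm_bounds[OF x] by (metis mult_zero_right order_antisym std_norm_eq_0 std_norm_nonneg)
qed (auto intro: orlicz_norm_scaleR orlicz_norm_triangle)

lemma strongly_euclidean_orlicz_norm: "strongly_euclidean 2 (orlicz_norm n) (Rn n)"
  unfolding strongly_euclidean_def using orlicz_norm_bounds by (intro exI[of _ 1]) auto

section \<open>The gradient of the Orlicz sum\<close>

definition orlicz_grad :: "(nat \<Rightarrow>\<^sub>0 real) \<Rightarrow> (nat \<Rightarrow>\<^sub>0 real)" where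
  "orlicz_grad x = Poly_Mapping.map young_deriv x"

lemma coord_orlicz_grad: "coord (orlicz_grad x) i = young_deriv (coord x i)"
  by (simp add: orlicz_grad_def map.rep_eq when_def)

lemma orlicz_grad_Rn: "x \<in> Rn n \<Longrightarrow> orlicz_grad x \<in> Rn n"
  by (auto simp: Rn_def in_keys_iff coord_orlicz_grad subset_iff) (metis young_deriv_0)

text \<open>\<open>young_add_le\<close> summed over coordinates. It serves both the descent step and
  the error of a small rescaling.\<close>

lemma orlicz_sum_add_le:
  assumes "x \<in> Rn n" "h \<in> Rn n"
  shows "orlicz_sum n (x + h) \<le> orlicz_sum n x + std_inner (orlicz_grad x) h + 3 * std_inner h h"
  unfolding orlicz_sum_def std_inner_Rn[OF orlicz_grad_Rn[OF assms(1)]] std_inner_Rn[OF assms(2)]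
    sum_distrib_left sum.distrib[symmetric] lookup_add coord_orlicz_grad
  by (intro sum_mono) (use young_add_le in \<open>simp add: power2_eq_square\<close>)

lemma std_inner_grad_self_le:
  assumes "x \<in> Rn n"
  shows "std_inner (orlicz_grad x) x \<le> 5 * std_inner x x"
    "std_inner (orlicz_grad x) (orlicz_grad x) \<le> 25 * std_inner x x"
proof -
  show "std_inner (orlicz_grad x) x \<le> 5 * std_inner x x"
    unfolding std_inner_Rn[OF orlicz_grad_Rn[OF assms]] std_inner_Rn[OF assms] sum_distrib_left coord_orlicz_grad
  proof (rule sum_mono)
    fix i
    have "young_deriv (coord x i) * coord x i \<le> \<bar>young_deriv (coord x i)\<bar> * \<bar>coord x i\<bar>"
      by (simp add: abs_mult[symmetric])
    also have "\<dots> \<le> 5 * \<bar>coord x i\<bar> * \<bar>coord x i\<bar>"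
      by (intro mult_right_mono abs_young_deriv_le) auto
    finally show "young_deriv (coord x i) * coord x i \<le> 5 * (coord x i * coord x i)" by simp
  qed
  show "std_inner (orlicz_grad x) (orlicz_grad x) \<le> 25 * std_inner x x"
    unfolding std_inner_Rn[OF orlicz_grad_Rn[OF assms]] std_inner_Rn[OF assms] sum_distrib_left coord_orlicz_grad
  proof (rule sum_mono)
    fix i
    have "\<bar>young_deriv (coord x i)\<bar> * \<bar>young_deriv (coord x i)\<bar> \<le> (5 * \<bar>coord x i\<bar>) * (5 * \<bar>coord x i\<bar>)"
      by (intro mult_mono abs_young_deriv_le) auto
    then show "young_deriv (coord x i) * young_deriv (coord x i) \<le> 25 * (coord x i * coord x i)" by simp
  qed
qed

section \<open>Planes\<close>

text \<open>Expand and swap the indices in one of the two mixed sums. Ordered pairs are counted,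
  hence the factor 2.\<close>

lemma lagrange_identity:
  fixes a b :: "'i \<Rightarrow> real"
  shows "(\<Sum>i\<in>I. \<Sum>j\<in>I. (a i * b j - a j * b i)\<^sup>2)
    = 2 * ((\<Sum>i\<in>I. (a i)\<^sup>2) * (\<Sum>i\<in>I. (b i)\<^sup>2) - (\<Sum>i\<in>I. a i * b i)\<^sup>2)"
proof -
  have "(\<Sum>i\<in>I. \<Sum>j\<in>I. (a i * b j - a j * b i)\<^sup>2)
      = (\<Sum>i\<in>I. \<Sum>j\<in>I. (a i)\<^sup>2 * (b j)\<^sup>2) + (\<Sum>i\<in>I. \<Sum>j\<in>I. (a j)\<^sup>2 * (b i)\<^sup>2)
       - 2 * (\<Sum>i\<in>I. \<Sum>j\<in>I. (a i * b i) * (a j * b j))"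
    by (simp add: power2_diff power_mult_distrib sum.distrib sum_subtractf sum_distrib_left algebra_simps)
  also have "(\<Sum>i\<in>I. \<Sum>j\<in>I. (a j)\<^sup>2 * (b i)\<^sup>2) = (\<Sum>i\<in>I. \<Sum>j\<in>I. (a i)\<^sup>2 * (b j)\<^sup>2)"
    by (rule sum.swap)
  finally show ?thesis
    by (simp add: sum_product power2_eq_square)
qed

lemma orth_proj_props:
  assumes "subspace Y" "Y \<subseteq> Rn n"
  shows "orth_proj Y x \<in> Y" "y \<in> Y \<Longrightarrow> std_inner (x - orth_proj Y x) y = 0"
  using theI'[OF orth_proj_ex1[OF assms, of x]] unfolding orth_proj_def by blast+

lemma std_inner_nonneg [simp]: "0 \<le> std_inner x x"
  by (simp add: std_inner_def sum_nonneg)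

lemmas std_inner_linear = std_inner_add_left std_inner_add_right std_inner_diff_left std_inner_diff_right
  std_inner_scaleR_left std_inner_scaleR_right

text \<open>Moving from \<open>y\<close> against the component \<open>w\<close> of the gradient orthogonal to \<open>y\<close> decreases
  the Orlicz sum, hence the norm, by an amount of order \<open>|w|\<^sup>2\<close>. The projection to \<open>Y\<close> of the
  resulting point is at least as long as \<open>y\<close>, so the assumptions on \<open>Y\<close> allow only a small decrease.\<close>
lemma gradient_almost_radial:
  assumes Y: "subspace Y" "Y \<subseteq> Rn n" and \<epsilon>: "0 < \<epsilon>" "(1 + \<epsilon>) ^ 4 - 1 \<le> 1"
    and compl: "strongly_complemented n (1 + \<epsilon>) (orlicz_norm n) Y"
    and eucl: "\<And>y. y \<in> Y \<Longrightarrow> t * std_norm y \<le> orlicz_norm n y"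
      "\<And>y. y \<in> Y \<Longrightarrow> orlicz_norm n y \<le> (1 + \<epsilon>) * t * std_norm y"
    and t: "t > 0" and y: "y \<in> Y" "t * std_norm y * (1 + \<epsilon>)\<^sup>2 = 1"
    and w: "w = orlicz_grad y - c *\<^sub>R y" "std_inner w y = 0"
  shows "std_inner w w \<le> 192 * ((1 + \<epsilon>) ^ 4 - 1) * std_inner y y"
proof -
  define \<delta> where "\<delta> = (1 + \<epsilon>) ^ 4 - 1"
  have \<delta>: "0 \<le> \<delta>" "\<delta> \<le> 1" using \<epsilon> by (auto simp: \<delta>_def)
  \<comment> \<open>The step 1/6 minimises - s + 3 \<open>s\<^sup>2\<close>, the bound from
    \<open>orlicz_sum_add_le\<close> in units of |w|^2; the gain is 1/12.\<close>
  define x where "x = y - (1 / 6) *\<^sub>R w"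
  define p where "p = orth_proj Y x"
  have yR: "y \<in> Rn n" using y Y by auto
  have wR: "w \<in> Rn n" unfolding w(1)
    by (intro subspace_diff[OF subspace_Rn] subspace_scale[OF subspace_Rn] orlicz_grad_Rn yR)
  have xR: "x \<in> Rn n" unfolding x_def
    by (intro subspace_diff[OF subspace_Rn] subspace_scale[OF subspace_Rn] wR yR)
  have yw: "std_inner y w = 0" using w(2) by (simp add: std_inner_commute)
  have grad: "orlicz_grad y = w + c *\<^sub>R y" using w(1) by simp
  have gw: "std_inner (orlicz_grad y) w = std_inner w w"
    unfolding grad by (simp add: std_inner_linear yw)
  have "std_inner (orlicz_grad y) (orlicz_grad y) = std_inner w w + c\<^sup>2 * std_inner y y"
    unfolding grad by (simp add: std_inner_linear yw w(2) power2_eq_square)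
  moreover have "0 \<le> c\<^sup>2 * std_inner y y" by simp
  ultimately have ww: "std_inner w w \<le> 25 * std_inner y y"
    using std_inner_grad_self_le(2)[OF yR] by linarith
  have "std_inner x x = std_inner y y + std_inner w w / 36"
    unfolding x_def by (simp add: std_inner_linear yw w(2))
  then have xx: "std_inner x x \<le> 2 * std_inner y y"
    using ww std_inner_nonneg[of y] by linarith

  \<comment> \<open>As y is in Y and w is orthogonal to y, p and x have the same inner product with
    y, namely |y|^2. So p is at least as long as y.\<close>
  have pY: "p \<in> Y" and "std_inner (x - p) y = 0"
    unfolding p_def using orth_proj_props[OF Y] y by auto
  then have "std_inner p y = std_inner y y"
    by (simp add: x_def std_inner_linear w(2))
  moreover have "0 \<le> std_inner (p - y) (p - y)" by simp
  ultimately have "std_inner y y \<le> std_inner p p"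
    by (simp add: std_inner_linear std_inner_commute[of y p])
  then have "std_norm y \<le> std_norm p" by (simp add: std_norm_eq_sqrt_inner)
  then have "t * std_norm y \<le> t * std_norm p" using t by simp
  also have "\<dots> \<le> orlicz_norm n p" by (rule eucl(1)[OF pY])
  also have "\<dots> \<le> (1 + \<epsilon>) * orlicz_norm n x"
    using compl xR unfolding strongly_complemented_def p_def by blast
  finally have "t * std_norm y * (1 + \<epsilon>)\<^sup>2 \<le> (1 + \<epsilon>) * orlicz_norm n x * (1 + \<epsilon>)\<^sup>2"
    by (intro mult_right_mono) auto
  then have Nx: "1 \<le> (1 + \<epsilon>) ^ 3 * orlicz_norm n x"
    unfolding y(2) by (simp add: power2_eq_square power3_eq_cube mult_ac)
  have Nx_pos: "0 < orlicz_norm n x"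
  proof (rule ccontr)
    assume "\<not> 0 < orlicz_norm n x"
    then have "(1 + \<epsilon>) ^ 3 * orlicz_norm n x \<le> 0" using \<epsilon> by (intro mult_nonneg_nonpos) auto
    then show False using Nx by simp
  qed
  \<comment> \<open>A fourth factor makes the inequality strict, so that the inverse fourth power is
    not admissible for x.\<close>
  have "(1 + \<epsilon>) ^ 3 * orlicz_norm n x < (1 + \<epsilon>) ^ 4 * orlicz_norm n x"
    using \<epsilon> Nx_pos by (intro mult_strict_right_mono power_strict_increasing) auto
  then have "inverse ((1 + \<epsilon>) ^ 4) < orlicz_norm n x"
    using Nx \<epsilon> by (simp add: field_simps)
  then have "\<not> orlicz_sum n (((1 + \<epsilon>) ^ 4) *\<^sub>R x) \<le> 1"
    using orlicz_norm_le[of "inverse ((1 + \<epsilon>) ^ 4)" n x] \<epsilon> by auto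
  moreover have "((1 + \<epsilon>) ^ 4) *\<^sub>R x = x + \<delta> *\<^sub>R x"
    by (simp add: \<delta>_def scaleR_diff_left)
  ultimately have "1 < orlicz_sum n (x + \<delta> *\<^sub>R x)" by simp
  also have "\<dots> \<le> orlicz_sum n x + \<delta> * std_inner (orlicz_grad x) x + 3 * (\<delta> * (\<delta> * std_inner x x))"
    using orlicz_sum_add_le[OF xR subspace_scale[OF subspace_Rn xR], of \<delta>] by (simp add: std_inner_linear)
  \<comment> \<open>Here \<delta> \<le> 1 replaces one factor \<delta>, giving 5 + 3 = 8.\<close>
  also have "\<dots> \<le> orlicz_sum n x + \<delta> * (5 * std_inner x x) + 3 * (\<delta> * (1 * std_inner x x))"
    using \<delta> std_inner_grad_self_le(1)[OF xR]
    by (intro add_mono mult_left_mono mult_right_mono) auto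
  also have "\<dots> = orlicz_sum n x + 8 * \<delta> * std_inner x x" by simp
  also have "\<dots> \<le> orlicz_sum n x + 8 * \<delta> * (2 * std_inner y y)"
    using xx \<delta> by (intro add_left_mono mult_left_mono) auto
  also have "orlicz_sum n x \<le> orlicz_sum n y - std_inner w w / 12"
  proof -
    have "x = y + (- (1 / 6)) *\<^sub>R w" by (simp add: x_def)
    then show ?thesis
      using orlicz_sum_add_le[OF yR subspace_scale[OF subspace_Rn wR], of "- (1 / 6)"]
      by (simp only: std_inner_linear gw)
  qed
  \<comment> \<open>The normalisation of y bounds its norm by 1 / (1 + \<epsilon>), strictly below
    1.\<close>
  also have "orlicz_sum n y \<le> 1"
  proof -
    have "orlicz_norm n y * (1 + \<epsilon>) \<le> (1 + \<epsilon>) * t * std_norm y * (1 + \<epsilon>)"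
      using eucl(2)[OF y(1)] \<epsilon> by (intro mult_right_mono) auto
    also have "\<dots> = 1" using y(2) by (simp add: power2_eq_square mult_ac)
    finally have "orlicz_norm n y * (1 + \<epsilon>) \<le> 1" .
    have "orlicz_norm n y < 1"
    proof (rule ccontr)
      assume "\<not> orlicz_norm n y < 1"
      then have "1 * (1 + \<epsilon>) \<le> orlicz_norm n y * (1 + \<epsilon>)" using \<epsilon> by (intro mult_right_mono) auto
      also note \<open>orlicz_norm n y * (1 + \<epsilon>) \<le> 1\<close>
      finally show False using \<epsilon>(1) by simp
    qed
    then show ?thesis using orlicz_sum_le_1[OF yR, of 1] by simp
  qed
  \<comment> \<open>The gain |w|^2 / 12 is less than 8 * 2 * \<delta> |y|^2, whence 192.\<close>
  finally show ?thesis unfolding \<delta>_def[symmetric] by simp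
qed

text \<open>Gram-Schmidt and rescaling. The common length makes the whole circle through u and v
  consist of vectors of length R.\<close>

lemma exists_orthogonal_pair:
  assumes Y: "subspace Y" "dim Y = 2" and R: "R > 0"
  obtains u v where "u \<in> Y" "v \<in> Y" "std_inner u v = 0" "std_inner u u = R\<^sup>2" "std_inner v v = R\<^sup>2"
proof -
  obtain B where B: "B \<subseteq> Y" "independent B" "card B = 2"
    using basis_exists[of Y] Y(2) by metis
  then obtain a b where ab: "B = {a, b}" "a \<noteq> b" by (meson card_2_iff)
  define d where "d = b - (std_inner a b / std_inner a a) *\<^sub>R a"
  have a0: "a \<noteq> 0" using B(2) ab dependent_zero by blast
  have "b \<notin> span {a}"
    using B(2) ab by (metis independent_insert insert_commute singletonD)
  then have d0: "d \<noteq> 0"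
    unfolding d_def by (metis eq_iff_diff_eq_0 span_base span_scale singletonI)
  have aY: "a \<in> Y" and dY: "d \<in> Y"
    using B ab Y(1) unfolding d_def by (auto intro!: subspace_diff subspace_scale)
  have ad: "std_inner a d = 0"
    using a0 by (simp add: d_def std_inner_linear std_inner_self_eq_0)
  have pos: "0 < std_inner z z" if "z \<noteq> 0" for z
    using that std_inner_nonneg[of z] std_inner_self_eq_0[of z] by linarith
  show thesis
  proof
    show "(R / std_norm a) *\<^sub>R a \<in> Y" "(R / std_norm d) *\<^sub>R d \<in> Y"
      using aY dY Y(1) by (auto intro: subspace_scale)
    show "std_inner ((R / std_norm a) *\<^sub>R a) ((R / std_norm d) *\<^sub>R d) = 0"
      by (simp add: std_inner_linear ad)
    show "std_inner ((R / std_norm a) *\<^sub>R a) ((R / std_norm a) *\<^sub>R a) = R\<^sup>2"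
      "std_inner ((R / std_norm d) *\<^sub>R d) ((R / std_norm d) *\<^sub>R d) = R\<^sup>2"
      using a0 d0 R by (simp_all flip: std_norm_power2 add: std_norm_scaleR)
  qed
qed

text \<open>By Lagrange's identity the sum is twice the Gram determinant of gradient and x, which
  equals |w|^2 |x|^2 for w the component of the gradient orthogonal to x.\<close>

lemma sum_crossed_eq:
  assumes "x \<in> Rn n" "x \<noteq> 0"
  obtains w c where "w = orlicz_grad x - c *\<^sub>R x" "std_inner w x = 0"
    "(\<Sum>i<n. \<Sum>j<n. (crossed (coord x i) (coord x j))\<^sup>2) = 2 * std_inner w w * std_inner x x"
proof
  let ?g = "orlicz_grad x"
  define c where "c = std_inner ?g x / std_inner x x"
  have c: "c * std_inner x x = std_inner ?g x"
    using assms(2) by (simp add: c_def std_inner_self_eq_0)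
  show "?g - c *\<^sub>R x = ?g - c *\<^sub>R x" ..
  show w: "std_inner (?g - c *\<^sub>R x) x = 0"
    using c by (simp add: std_inner_linear)
  have "std_inner (?g - c *\<^sub>R x) (?g - c *\<^sub>R x)
      = std_inner (?g - c *\<^sub>R x) ?g - c * std_inner (?g - c *\<^sub>R x) x"
    by (simp only: std_inner_diff_right std_inner_scaleR_right)
  also have "\<dots> = std_inner ?g ?g - c * std_inner ?g x"
    unfolding w by (simp add: std_inner_diff_left std_inner_scaleR_left std_inner_commute[of x ?g])
  finally have "std_inner (?g - c *\<^sub>R x) (?g - c *\<^sub>R x) * std_inner x x
      = (std_inner ?g ?g - c * std_inner ?g x) * std_inner x x"
    by (rule arg_cong)
  also have "\<dots> = std_inner ?g ?g * std_inner x x - std_inner ?g x * (c * std_inner x x)"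
    by (simp add: algebra_simps)
  finally have "std_inner (?g - c *\<^sub>R x) (?g - c *\<^sub>R x) * std_inner x x
      = std_inner ?g ?g * std_inner x x - (std_inner ?g x)\<^sup>2"
    unfolding c power2_eq_square .
  moreover have "(\<Sum>i<n. \<Sum>j<n. (crossed (coord x i) (coord x j))\<^sup>2)
      = 2 * (std_inner ?g ?g * std_inner x x - (std_inner ?g x)\<^sup>2)"
    unfolding crossed_def using lagrange_identity[of "coord ?g" "coord x" "{..<n}"]
    by (simp add: coord_orlicz_grad std_inner_Rn[OF orlicz_grad_Rn[OF assms(1)]] std_inner_Rn[OF assms(1)]
      power2_eq_square)
  ultimately show "(\<Sum>i<n. \<Sum>j<n. (crossed (coord x i) (coord x j))\<^sup>2)
      = 2 * std_inner (?g - c *\<^sub>R x) (?g - c *\<^sub>R x) * std_inner x x"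
    by simp
qed

theorem theorem1p4:
  shows "\<exists>\<epsilon>::real. \<exists>C::real. \<epsilon> > 0 \<and> C \<ge> 1 \<and>
    (\<forall>\<^sub>F n::nat in sequentially.
      \<exists>N :: (nat \<Rightarrow>\<^sub>0 real) \<Rightarrow> real.
        norm_on (Rn n) N \<and>
        strongly_euclidean C N (Rn n) \<and>
        \<not> (\<exists>Y. subspace Y \<and> Y \<subseteq> Rn n \<and> dim Y = 2 \<and>
              strongly_euclidean (1 + \<epsilon>) N Y \<and>
              strongly_complemented n (1 + \<epsilon>) N Y))"
proof -
  obtain \<kappa> where \<kappa>: "\<kappa> > 0" "\<And>a a' b b'. \<kappa> * (a * b' - a' * b)\<^sup>2 \<le>
      (\<Sum>\<theta>\<in>test_angles. (crossed (cos \<theta> * a + sin \<theta> * a') (cos \<theta> * b + sin \<theta> * b'))\<^sup>2)"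
    using young_deriv_transversal by blast
  define M where "M = real (card test_angles)"
  \<comment> \<open>The first bound yields \<delta> \<le> 1, the second
    \<open>192 * \<delta> * M < \<kappa>\<close>; M + 1 provides strictness.\<close>
  define \<epsilon> where "\<epsilon> = min (1 / 15) (\<kappa> / (192 * 15 * (M + 1)))"
  define \<delta> where "\<delta> = (1 + \<epsilon>) ^ 4 - 1"
  have M: "0 \<le> M" by (simp add: M_def)
  have "\<epsilon> \<le> 1 / 15" unfolding \<epsilon>_def by (rule min.cobounded1)
  moreover have "0 < \<epsilon>" using \<kappa>(1) M by (simp add: \<epsilon>_def)
  ultimately have \<epsilon>: "0 < \<epsilon>" "\<epsilon> \<le> 1 / 15" by auto
  \<comment> \<open>Higher powers of \<epsilon> are at most \<epsilon>, and 15 = 4 + 6 + 4 +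
    1.\<close>
  have \<delta>\<epsilon>: "\<delta> \<le> 15 * \<epsilon>"
  proof -
    have "\<epsilon>\<^sup>2 \<le> \<epsilon> ^ 1" "\<epsilon> ^ 3 \<le> \<epsilon> ^ 1" "\<epsilon> ^ 4 \<le> \<epsilon> ^ 1"
      by (rule power_decreasing; use \<epsilon> in simp)+
    then have "\<epsilon>\<^sup>2 \<le> \<epsilon>" "\<epsilon> ^ 3 \<le> \<epsilon>" "\<epsilon> ^ 4 \<le> \<epsilon>"
      by simp_all
    moreover have "\<delta> = 4 * \<epsilon> + 6 * \<epsilon>\<^sup>2 + 4 * \<epsilon> ^ 3 + \<epsilon> ^ 4"
      unfolding \<delta>_def by algebra
    ultimately show ?thesis by linarith
  qed
  then have \<delta>1: "(1 + \<epsilon>) ^ 4 - 1 \<le> 1" using \<epsilon> by (simp add: \<delta>_def)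
  have "192 * \<delta> * M < \<kappa>"
  proof -
    have "\<epsilon> \<le> \<kappa> / (192 * 15 * (M + 1))" unfolding \<epsilon>_def by (rule min.cobounded2)
    then have "\<epsilon> * (192 * 15 * (M + 1)) \<le> \<kappa>" using M by (subst (asm) pos_le_divide_eq) auto
    moreover have "192 * \<delta> * M \<le> 192 * (15 * \<epsilon>) * M"
      using \<delta>\<epsilon> M by (intro mult_right_mono mult_left_mono) auto
    moreover have "192 * (15 * \<epsilon>) * M < \<epsilon> * (192 * 15 * (M + 1))" using \<epsilon> by (simp add: algebra_simps)
    ultimately show ?thesis by linarith
  qed
  have "\<not> (subspace Y \<and> Y \<subseteq> Rn n \<and> dim Y = 2 \<and> strongly_euclidean (1 + \<epsilon>) (orlicz_norm n) Y \<and>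
      strongly_complemented n (1 + \<epsilon>) (orlicz_norm n) Y)" for n Y
  proof
    assume asm: "subspace Y \<and> Y \<subseteq> Rn n \<and> dim Y = 2 \<and> strongly_euclidean (1 + \<epsilon>) (orlicz_norm n) Y \<and>
      strongly_complemented n (1 + \<epsilon>) (orlicz_norm n) Y"
    then obtain t where t: "t > 0" "\<And>y. y \<in> Y \<Longrightarrow> t * std_norm y \<le> orlicz_norm n y"
        "\<And>y. y \<in> Y \<Longrightarrow> orlicz_norm n y \<le> (1 + \<epsilon>) * t * std_norm y"
      unfolding strongly_euclidean_def by blast
    \<comment> \<open>The length at which \<open>gradient_almost_radial\<close> applies on the
      circle.\<close>
    define R where "R = 1 / (t * (1 + \<epsilon>)\<^sup>2)"
    have R: "R > 0" using t(1) \<epsilon> by (simp add: R_def)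
    obtain u v where uv: "u \<in> Y" "v \<in> Y" "std_inner u v = 0" "std_inner u u = R\<^sup>2" "std_inner v v = R\<^sup>2"
      using exists_orthogonal_pair[OF _ _ R] asm by metis
    define y where "y \<theta> = cos \<theta> *\<^sub>R u + sin \<theta> *\<^sub>R v" for \<theta>
    have yY: "y \<theta> \<in> Y" for \<theta>
      unfolding y_def using uv asm by (intro subspace_add subspace_scale) auto
    have yy: "std_inner (y \<theta>) (y \<theta>) = R\<^sup>2" for \<theta>
    proof -
      have "std_inner (y \<theta>) (y \<theta>)
          = (cos \<theta>)\<^sup>2 * std_inner u u + 2 * cos \<theta> * sin \<theta> * std_inner u v + (sin \<theta>)\<^sup>2 * std_inner v v"
        by (simp add: y_def std_inner_linear std_inner_commute[of v u] power2_eq_square algebra_simps)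
      also have "\<dots> = ((cos \<theta>)\<^sup>2 + (sin \<theta>)\<^sup>2) * R\<^sup>2" unfolding uv by (simp add: distrib_right del: sin_cos_squared_add sin_cos_squared_add2)
      finally show ?thesis by simp
    qed
    have small: "(\<Sum>i<n. \<Sum>j<n. (crossed (coord (y \<theta>) i) (coord (y \<theta>) j))\<^sup>2) \<le> 2 * (192 * \<delta> * R\<^sup>2) * R\<^sup>2" for \<theta>
    proof -
      have "y \<theta> \<noteq> 0" using yy[of \<theta>] R by (metis power_not_zero order_less_irrefl std_inner_self_eq_0)
      then obtain w c where w: "w = orlicz_grad (y \<theta>) - c *\<^sub>R y \<theta>" "std_inner w (y \<theta>) = 0" and
        eq: "(\<Sum>i<n. \<Sum>j<n. (crossed (coord (y \<theta>) i) (coord (y \<theta>) j))\<^sup>2) = 2 * std_inner w w * R\<^sup>2"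
        using sum_crossed_eq[of "y \<theta>" n] yY asm unfolding yy by blast
      have "t * std_norm (y \<theta>) * (1 + \<epsilon>)\<^sup>2 = 1"
        using R t(1) \<epsilon> by (simp add: std_norm_eq_sqrt_inner yy) (simp add: R_def)
      then have "std_inner w w \<le> 192 * \<delta> * R\<^sup>2"
        using gradient_almost_radial[OF _ _ \<epsilon>(1) \<delta>1 _ t(2,3,1) yY _ w] asm by (simp add: \<delta>_def yy)
      then show ?thesis unfolding eq by (intro mult_right_mono mult_left_mono) auto
    qed
    \<comment> \<open>Lagrange's identity for the orthogonal pair u, v turns the total
      transversality into a power of R alone, independent of n.\<close>
    have "\<kappa> * (2 * (R\<^sup>2 * R\<^sup>2)) = \<kappa> * (\<Sum>i<n. \<Sum>j<n. (coord u i * coord v j - coord u j * coord v i)\<^sup>2)"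
    proof -
      have "u \<in> Rn n" "v \<in> Rn n" using uv asm by auto
      then have "(\<Sum>i<n. (coord u i)\<^sup>2) = R\<^sup>2" "(\<Sum>i<n. (coord v i)\<^sup>2) = R\<^sup>2" "(\<Sum>i<n. coord u i * coord v i) = 0"
        using uv by (simp_all add: std_inner_Rn power2_eq_square)
      then show ?thesis by (simp add: lagrange_identity)
    qed
    also have "\<dots> \<le> (\<Sum>i<n. \<Sum>j<n. \<Sum>\<theta>\<in>test_angles. (crossed (coord (y \<theta>) i) (coord (y \<theta>) j))\<^sup>2)"
      unfolding sum_distrib_left y_def lookup_add lookup_scaleR real_scaleR_def
      by (intro sum_mono order_trans[OF _ \<kappa>(2)]) (simp add: mult.commute)
    \<comment> \<open>Moving the angle outermost lets \<open>small\<close> bound the sum over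
      coordinate pairs for each angle.\<close>
    also have "\<dots> = (\<Sum>i<n. \<Sum>\<theta>\<in>test_angles. \<Sum>j<n. (crossed (coord (y \<theta>) i) (coord (y \<theta>) j))\<^sup>2)"
      by (rule sum.cong[OF refl sum.swap])
    also have "\<dots> = (\<Sum>\<theta>\<in>test_angles. \<Sum>i<n. \<Sum>j<n. (crossed (coord (y \<theta>) i) (coord (y \<theta>) j))\<^sup>2)"
      by (rule sum.swap)
    also have "\<dots> \<le> (\<Sum>\<theta>\<in>test_angles. 2 * (192 * \<delta> * R\<^sup>2) * R\<^sup>2)"
      by (intro sum_mono small)
    also have "\<dots> = 192 * \<delta> * M * (2 * (R\<^sup>2 * R\<^sup>2))" by (simp add: M_def)
    finally have "\<kappa> * (2 * (R\<^sup>2 * R\<^sup>2)) \<le> 192 * \<delta> * M * (2 * (R\<^sup>2 * R\<^sup>2))" .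
    moreover have "192 * \<delta> * M * (2 * (R\<^sup>2 * R\<^sup>2)) < \<kappa> * (2 * (R\<^sup>2 * R\<^sup>2))"
      using \<open>192 * \<delta> * M < \<kappa>\<close> R by (intro mult_strict_right_mono) auto
    ultimately show False by (rule leD[THEN notE])
  qed
  then show ?thesis
    using \<epsilon>(1) norm_on_orlicz_norm strongly_euclidean_orlicz_norm
    by (intro exI[of _ \<epsilon>] exI[of _ 2] conjI always_eventually allI) (auto intro!: exI[of _ "orlicz_norm _"])
qed

end
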